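(* There is an absolute constant $C$ such that for all $t,n\in\mathbb N$ the following holds. Let $\{\alpha_x\}_{x\in\{0,1\}^n}$ be independent uniformly random $\pm1$ values and define $$|\psi\rangle=2^{-n/2}\sum_{x\in\{0,1\}^n}\alpha_x|x\rangle .$$ Then $$\mathrm{TD}\Big(\mathbb E\,|\psi\rangle\langle\psi|^{\otimes t},\ \mathbb E\,|\vartheta\rangle\langle\vartheta|^{\otimes t}\Big)\le C\,\frac{t^2}{2^n},$$ where $|\vartheta\rangle$ is a Haar-random $n$-qubit state and the expectations are over the $\alpha_x$ and over $|\vartheta\rangle$ respectively.
   Context: $\mathrm{TD}(\rho,\sigma)=\frac12\|\rho-\sigma\|_1$ is the trace distance. A Haar-random $n$-qubit state is a uniformly random (unitarily invariant) unit vector in $(\mathbb C^2)^{\otimes n}$. *)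

theory Defs
  imports "HOL-Probability.Probability" "Jordan_Normal_Form.Schur_Decomposition"
begin

hide_const (open) Finite_Cartesian_Product.vec Finite_Cartesian_Product.mat
hide_type (open) Finite_Cartesian_Product.vec
no_notation Finite_Cartesian_Product.vec_nth (infixl "$" 90)

text \<open>Operators on a \<open>d\<close>-dimensional complex Hilbert space are \<open>d \<times> d\<close> matrices in the computational
  basis. For \<open>n\<close> qubits, \<open>d = 2 ^ n\<close> and the bit string \<open>x \<in> {0,1}\<^sup>n\<close> is identified with the number
  \<open>x < 2 ^ n\<close> it represents in binary.\<close>

definition ket_bra :: "complex vec \<Rightarrow> complex mat" where
  "ket_bra v = mat (dim_vec v) (dim_vec v) (\<lambda>(i, j). v $ i * cnj (v $ j))"

definition kronecker :: "complex mat \<Rightarrow> complex mat \<Rightarrow> complex mat" where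
  "kronecker A B = mat (dim_row A * dim_row B) (dim_col A * dim_col B)
     (\<lambda>(i, j). A $$ (i div dim_row B, j div dim_col B) * B $$ (i mod dim_row B, j mod dim_col B))"

primrec tensor_power :: "complex mat \<Rightarrow> nat \<Rightarrow> complex mat" where
  "tensor_power A 0 = 1\<^sub>m 1"
| "tensor_power A (Suc t) = kronecker A (tensor_power A t)"

text \<open>The trace norm as the sum of the singular values: \<open>proots\<close> of the characteristic polynomial is
  the multiset of eigenvalues, with algebraic multiplicity, and the eigenvalues of \<open>A\<^sup>* A\<close> are real
  and nonnegative.\<close>

definition trace_norm :: "complex mat \<Rightarrow> real" where
  "trace_norm A = (\<Sum>z\<in>#proots (char_poly (mat_adjoint A * A)). sqrt (Re z))"

definition trace_distance :: "complex mat \<Rightarrow> complex mat \<Rightarrow> real" where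
  "trace_distance \<rho> \<sigma> = trace_norm (\<rho> - \<sigma>) / 2"

definition expectation_mat :: "nat \<Rightarrow> 'a measure \<Rightarrow> ('a \<Rightarrow> complex mat) \<Rightarrow> complex mat" where
  "expectation_mat d M X = mat d d (\<lambda>(i, j). \<integral>\<omega>. X \<omega> $$ (i, j) \<partial>M)"

text \<open>The outcome of \<open>random_signs N\<close> is a family of independent uniform signs \<open>\<alpha> x\<close> for \<open>x < N\<close>;
  the value \<open>\<alpha> x = 1\<close> for \<open>x \<ge> N\<close> is an unused default.\<close>

definition random_signs :: "nat \<Rightarrow> (nat \<Rightarrow> real) pmf" where
  "random_signs N = Pi_pmf {..<N} 1 (\<lambda>_. pmf_of_set {-1, 1})"

definition binary_phase_state :: "nat \<Rightarrow> (nat \<Rightarrow> real) \<Rightarrow> complex vec" where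
  "binary_phase_state n \<alpha> = vec (2 ^ n) (\<lambda>x. complex_of_real (\<alpha> x / sqrt (2 ^ n)))"

text \<open>The Borel sigma-algebra of \<open>\<complex>\<^sup>d\<close>, transported to the vectors of dimension \<open>d\<close>.\<close>

definition borel_vec :: "nat \<Rightarrow> complex vec measure" where
  "borel_vec d = vimage_algebra (carrier_vec d) (\<lambda>v. \<lambda>i\<in>{..<d}. v $ i) (\<Pi>\<^sub>M i\<in>{..<d}. borel)"

definition unitary_mat :: "nat \<Rightarrow> complex mat \<Rightarrow> bool" where
  "unitary_mat d U \<longleftrightarrow> U \<in> carrier_mat d d \<and> mat_adjoint U * U = 1\<^sub>m d"

text \<open>\<open>\<mu>\<close> is the law of a Haar-random state: a unitarily invariant probability measure carried by
  the unit sphere of \<open>\<complex>\<^sup>d\<close>. For \<open>d > 0\<close> there is exactly one such \<open>\<mu>\<close>.\<close>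

definition haar_state_measure :: "nat \<Rightarrow> complex vec measure \<Rightarrow> bool" where
  "haar_state_measure d \<mu> \<longleftrightarrow>
     prob_space \<mu> \<and> sets \<mu> = sets (borel_vec d) \<and> (AE v in \<mu>. v \<bullet>c v = 1) \<and>
     (\<forall>U. unitary_mat d U \<longrightarrow> distr \<mu> \<mu> (\<lambda>v. U *\<^sub>v v) = \<mu>)"

end

theory Submission
  imports Defs
begin

text \<open>Let \<open>d = 2\<^sup>n\<close>. Both averaged states are matrices of moments \<open>E \<psi>\<^sub>l \<psi>\<^sub>k\<^sup>*\<close>, indexed by lists \<open>l\<close>, \<open>k\<close> of
  \<open>t\<close> basis labels, and both random vectors are invariant under flipping the sign of one coordinate,
  so a moment vanishes as soon as some label occurs an odd number of times in \<open>l\<close> and \<open>k\<close> together.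
  For a list \<open>l\<close> of distinct labels this leaves only the permutations \<open>k\<close> of \<open>l\<close>, and the moment is then
  \<open>E |\<psi>\<^sub>l|\<^sup>2\<close>, which does not depend on \<open>l\<close>. Hence on the span of the distinct lists the two states are
  proportional, and they have no matrix entries between this span and its orthogonal complement. The
  trace norm of the difference is therefore at most three times the larger of the two weights on the
  complement. Such a weight is a collision probability, at most \<open>(t\<^sup>2 / 2) E \<Sum>\<^sub>x |\<psi>\<^sub>x|\<^sup>4\<close>; the
  expectation is \<open>1 / d\<close> for signs and \<open>2 / (d + 1)\<close> for a Haar-random state. In the latter case unitary
  invariance gives \<open>E |\<psi>\<^sub>x + \<omega> \<psi>\<^sub>y|\<^sup>4 = 4 E |\<psi>\<^sub>x|\<^sup>4\<close> for \<open>|\<omega>| = 1\<close>, and summing over the four powers of \<open>\<i>\<close>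
  yields \<open>E |\<psi>\<^sub>x|\<^sup>2 |\<psi>\<^sub>y|\<^sup>2 = E |\<psi>\<^sub>x|\<^sup>4 / 2\<close>.\<close>

unbundle no inner_syntax

section \<open>Trace norm of Hermitian matrices\<close>

lemma mat_adjoint_index:
  assumes "i < dim_col A" "j < dim_row A"
  shows "mat_adjoint A $$ (i, j) = conjugate (A $$ (j, i))"
  using assms by (simp add: mat_adjoint_def mat_of_rows_def)

lemma mat_adjoint_dim [simp]:
  "dim_row (mat_adjoint A) = dim_col A" "dim_col (mat_adjoint A) = dim_row A"
  by (simp_all add: mat_adjoint_def)

lemma mat_adjoint_carrier [simp]: "A \<in> carrier_mat m n \<Longrightarrow> mat_adjoint A \<in> carrier_mat n m"
  by (metis carrier_matD carrier_matI mat_adjoint_dim)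

lemma mat_adjoint_mult:
  fixes A B :: "complex mat"
  assumes "A \<in> carrier_mat l m" "B \<in> carrier_mat m n"
  shows "mat_adjoint (A * B) = mat_adjoint B * mat_adjoint A"
proof (rule eq_matI)
  fix i j assume "i < dim_row (mat_adjoint B * mat_adjoint A)" "j < dim_col (mat_adjoint B * mat_adjoint A)"
  with assms show "mat_adjoint (A * B) $$ (i, j) = (mat_adjoint B * mat_adjoint A) $$ (i, j)"
    by (simp add: mat_adjoint_index scalar_prod_def mult.commute)
qed (use assms in auto)

lemma mat_adjoint_adjoint: "mat_adjoint (mat_adjoint (A :: complex mat)) = A"
  by (rule eq_matI) (auto simp: mat_adjoint_index)

lemma unitary_mat_carrier: "unitary_mat n U \<Longrightarrow> U \<in> carrier_mat n n"
  by (simp add: unitary_mat_def)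

lemma unitary_mat_right:
  assumes "unitary_mat n U"
  shows "U * mat_adjoint U = 1\<^sub>m n"
  using assms mat_mult_left_right_inverse[of "mat_adjoint U" n U] by (auto simp: unitary_mat_def)

lemma unitary_mat_mult:
  assumes U: "unitary_mat n U" and V: "unitary_mat n V"
  shows "unitary_mat n (U * V)"
proof -
  note [simp] = unitary_mat_carrier[OF U] unitary_mat_carrier[OF V] mult_carrier_mat[of _ n n _ n]
  have "mat_adjoint (U * V) * (U * V) = mat_adjoint V * mat_adjoint U * (U * V)"
    by (simp add: mat_adjoint_mult[of U n n V n])
  also have "\<dots> = mat_adjoint V * (mat_adjoint U * (U * V))"
    by (rule assoc_mult_mat[of _ n n _ n _ n]) auto
  also have "mat_adjoint U * (U * V) = mat_adjoint U * U * V"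
    by (rule assoc_mult_mat[symmetric, of _ n n _ n _ n]) auto
  also have "mat_adjoint V * \<dots> = 1\<^sub>m n"
    using assms by (simp add: unitary_mat_def left_mult_one_mat[of V n n])
  finally show ?thesis
    by (simp add: unitary_mat_def)
qed

text \<open>Complete \<open>v\<close> to a basis and orthogonalise it. Gram-Schmidt keeps the first
  vector, so normalising afterwards only rescales \<open>v\<close>. The resulting change of basis
  splits off an eigenvector in the spectral theorem.\<close>

lemma unitary_with_first_column:
  fixes v :: "complex vec"
  assumes v: "v \<in> carrier_vec n" "v \<noteq> 0\<^sub>v n"
  obtains W c where "unitary_mat n W" "col W 0 = c \<cdot>\<^sub>v v"
proof -
  interpret cof_vec_space n "TYPE(complex)" .
  define b where "b = basis_completion v"
  define ws where "ws = gram_schmidt n b"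
  note b = basis_completion[OF v, folded b_def]
  from b(7,6) v have "n \<noteq> 0" "b \<noteq> []" by auto
  then obtain vs where bv: "b = v # vs" using b(7) by (cases b) auto
  from gram_schmidt_result[OF b(2,4,5) refl, folded ws_def] b(6)
  have ws: "set ws \<subseteq> carrier_vec n" "corthogonal ws" "length ws = n" by auto
  have hd: "ws ! 0 = v"
    using gram_schmidt_hd[OF v(1), of vs] ws(3) \<open>n \<noteq> 0\<close>
    by (metis bv hd_conv_nth length_0_conv ws_def)
  \<comment> \<open>The list \<open>ws\<close> is orthogonal but not normalised; \<open>r i\<close>
    is the inverse norm of \<open>ws ! i\<close>.\<close>
  define r where "r i = complex_of_real (1 / sqrt (Re (ws ! i \<bullet>c ws ! i)))" for i
  define W where "W = mat_of_cols n (map (\<lambda>i. r i \<cdot>\<^sub>v ws ! i) [0..<n])"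
  have wsi: "ws ! i \<in> carrier_vec n" if "i < n" for i using ws that by auto
  have W: "W \<in> carrier_mat n n"
    unfolding W_def
    by (rule mat_of_cols_carrier(1)[of n "map (\<lambda>i. r i \<cdot>\<^sub>v ws ! i) [0..<n]", simplified])
  have colW: "col W i = r i \<cdot>\<^sub>v ws ! i" if "i < n" for i
    using that wsi unfolding W_def by (subst col_mat_of_cols) auto
  have "mat_adjoint W * W = 1\<^sub>m n"
  proof (rule eq_matI)
    fix i j assume "i < dim_row (1\<^sub>m n :: complex mat)" "j < dim_col (1\<^sub>m n :: complex mat)"
    then have ij: "i < n" "j < n" by auto
    have row: "row (mat_adjoint W) i = conjugate (col W i)"
      using ij W by (auto simp: mat_adjoint_def)
    have "(mat_adjoint W * W) $$ (i, j) = conjugate (col W i) \<bullet> col W j"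
      using ij W by (simp add: row)
    also have "\<dots> = col W j \<bullet>c col W i"
      using W by (intro comm_scalar_prod[of _ n]) auto
    also have "\<dots> = r j * r i * (ws ! j \<bullet>c ws ! i)"
      using ij wsi[OF ij(1)] wsi[OF ij(2)]
      by (simp add: colW conjugate_smult_vec r_def)
    also have "\<dots> = (if i = j then 1 else 0)"
    proof (cases "i = j")
      case True
      have "ws ! i \<bullet>c ws ! i \<ge> 0" by (rule conjugate_square_ge_0_vec) 
      moreover have "ws ! i \<bullet>c ws ! i \<noteq> 0"
        using corthogonalD[OF ws(2), of i i] ij ws(3) by auto
      ultimately have pos: "Re (ws ! i \<bullet>c ws ! i) > 0" "Im (ws ! i \<bullet>c ws ! i) = 0"
        by (auto simp: less_eq_complex_def complex_eq_iff)
      define s where "s = Re (ws ! i \<bullet>c ws ! i)"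
      have "s > 0" "ws ! i \<bullet>c ws ! i = complex_of_real s" "r i = complex_of_real (1 / sqrt s)"
        using pos by (auto simp: s_def r_def complex_eq_iff)
      moreover have "1 / sqrt s * (1 / sqrt s) * s = 1"
        using \<open>s > 0\<close> by (simp add: field_simps)
      ultimately show ?thesis
        using True by (metis of_real_1 of_real_mult)
    next
      case False
      then show ?thesis using corthogonalD[OF ws(2), of j i] ij ws(3) by auto
    qed
    finally show "(mat_adjoint W * W) $$ (i, j) = 1\<^sub>m n $$ (i, j)" using ij by simp
  qed (use W in auto)
  then have "unitary_mat n W" using W by (simp add: unitary_mat_def)
  moreover have "col W 0 = r 0 \<cdot>\<^sub>v v" using colW[of 0] hd \<open>n \<noteq> 0\<close> by simp
  ultimately show thesis by (rule that)
qed

text \<open>Deflation: in an orthonormal basis starting with an eigenvector the first column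
  vanishes below the diagonal, and as the matrix stays Hermitian, the first row vanishes beyond it.
  The remaining block is again Hermitian and falls under the induction hypothesis.\<close>

lemma hermitian_mat_diagonalization:
  fixes A :: "complex mat"
  assumes "A \<in> carrier_mat n n" "mat_adjoint A = A"
  shows "\<exists>U. unitary_mat n U \<and> diagonal_mat (mat_adjoint U * A * U)"
  using assms
proof (induction n arbitrary: A)
  case 0
  then show ?case
    by (intro exI[of _ "1\<^sub>m 0"]) (auto simp: unitary_mat_def diagonal_mat_def intro!: eq_matI)
next
  case (Suc n)
  let ?N = "Suc n"
  note A = Suc.prems(1)
  obtain as where as: "char_poly A = (\<Prod>a\<leftarrow>as. [:- a, 1:])" "length as = ?N"
    using char_poly_factorized[OF A] by blast
  then obtain e where "poly (char_poly A) e = 0"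
    by (cases as) auto
  then obtain v where v: "v \<in> carrier_vec ?N" "v \<noteq> 0\<^sub>v ?N" "A *\<^sub>v v = e \<cdot>\<^sub>v v"
    using A by (auto simp: eigenvalue_root_char_poly[OF A, symmetric] eigenvalue_def eigenvector_def)
  obtain W c where W: "unitary_mat ?N W" and Wv: "col W 0 = c \<cdot>\<^sub>v v"
    using unitary_with_first_column[OF v(1,2)] by blast
  note Wc [simp] = unitary_mat_carrier[OF W]
  note [simp] = A mult_carrier_mat[of _ ?N ?N _ ?N]
  define A' where "A' = mat_adjoint W * A * W"
  have A' [simp]: "A' \<in> carrier_mat ?N ?N"
    unfolding A'_def by (intro mult_carrier_mat[of _ ?N ?N] mat_adjoint_carrier) auto
  have A'adj: "mat_adjoint A' = A'"
    unfolding A'_def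
    using Suc.prems(2)
    by (simp add: mat_adjoint_mult[of _ ?N ?N _ ?N] mat_adjoint_adjoint
        assoc_mult_mat[of _ ?N ?N _ ?N _ ?N])
  have AW: "A *\<^sub>v col W 0 = e \<cdot>\<^sub>v col W 0"
    using v A by (simp add: Wv mult_mat_vec[of _ ?N ?N] smult_smult_assoc mult.commute)
  have [simp]: "col W 0 \<in> carrier_vec ?N"
    using carrier_matD[OF Wc] by (intro carrier_vecI) simp
  have "col A' 0 = mat_adjoint W *\<^sub>v (A *\<^sub>v col W 0)"
    using carrier_matD[OF A] carrier_matD[OF Wc] unfolding A'_def
    by (subst col_mult2[of _ ?N ?N _ ?N]) (auto simp: assoc_mult_mat_vec[of _ ?N ?N _ ?N])
  also have "\<dots> = e \<cdot>\<^sub>v (mat_adjoint W *\<^sub>v col W 0)"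
    using mult_mat_vec[of "mat_adjoint W" ?N ?N "col W 0" e] Wc
    by (simp add: AW)
  also have "mat_adjoint W *\<^sub>v col W 0 = col (mat_adjoint W * W) 0"
    using Wc by (subst col_mult2[of _ ?N ?N _ ?N]) auto
  also have "mat_adjoint W * W = 1\<^sub>m ?N" using W by (simp add: unitary_mat_def)
  finally have col0: "col A' 0 = e \<cdot>\<^sub>v col (1\<^sub>m ?N) 0" .
  have A'0: "A' $$ (i, 0) = (if i = 0 then e else 0)" if "i < ?N" for i
    using arg_cong[OF col0, of "\<lambda>w. w $ i"] that carrier_matD[OF A'] by simp
  have A'0': "A' $$ (0, i) = 0" if "i < ?N" "i \<noteq> 0" for i
    using mat_adjoint_index[of 0 A' i] A'0[OF that(1)] that carrier_matD[OF A'] by (simp add: A'adj)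
  define A3 where "A3 = mat n n (\<lambda>(i, j). A' $$ (Suc i, Suc j))"
  have A3 [simp]: "A3 \<in> carrier_mat n n" by (simp add: A3_def)
  have "mat_adjoint A3 = A3"
  proof (rule eq_matI)
    fix i j assume "i < dim_row A3" "j < dim_col A3"
    then show "mat_adjoint A3 $$ (i, j) = A3 $$ (i, j)"
      using mat_adjoint_index[of "Suc i" A' "Suc j"] carrier_matD[OF A']
      by (simp add: A3_def mat_adjoint_index A'adj)
  qed (auto simp: A3_def)
  from Suc.IH[OF A3 this] obtain U3 where U3: "unitary_mat n U3" "diagonal_mat (mat_adjoint U3 * A3 * U3)"
    by blast
  note U3c [simp] = unitary_mat_carrier[OF U3(1)]
  \<comment> \<open>\<open>bd a X\<close> is block diagonal with blocks \<open>a\<close> and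
    \<open>X\<close>. It respects products and adjoints, so the unitarity of \<open>U3\<close> and
    the diagonal form it produces lift to dimension \<open>Suc n\<close>.\<close>
  define bd where "bd a X = four_block_mat (mat 1 1 (\<lambda>_. a)) (0\<^sub>m 1 n) (0\<^sub>m n 1) X" for a :: complex and X
  have bd_carrier [simp]: "bd a X \<in> carrier_mat ?N ?N" if "X \<in> carrier_mat n n" for a X
    unfolding bd_def using that four_block_carrier_mat[of "mat 1 1 (\<lambda>_. a)" 1 1 X n n] by simp
  have bd_mult: "bd a X * bd b Y = bd (a * b) (X * Y)"
    if "X \<in> carrier_mat n n" "Y \<in> carrier_mat n n" for a b X Y
  proof -
    have "mat 1 1 (\<lambda>_. a) * mat 1 1 (\<lambda>_. b) = mat 1 1 (\<lambda>_. a * b)"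
      by (rule eq_matI) (auto simp: scalar_prod_def)
    then show ?thesis
      unfolding bd_def using that by (subst mult_four_block_mat[of _ 1 1 _ n _ n]) (auto intro!: cong_four_block_mat)
  qed
  have bd_adj: "mat_adjoint (bd a X) = bd (cnj a) (mat_adjoint X)" if "X \<in> carrier_mat n n" for a X
  proof (rule eq_matI)
    fix i j assume "i < dim_row (bd (cnj a) (mat_adjoint X))" "j < dim_col (bd (cnj a) (mat_adjoint X))"
    with that show "mat_adjoint (bd a X) $$ (i, j) = bd (cnj a) (mat_adjoint X) $$ (i, j)"
      by (auto simp: bd_def mat_adjoint_index)
  qed (use that in \<open>auto simp: bd_def\<close>)
  define V where "V = bd 1 U3"
  have Vc [simp]: "V \<in> carrier_mat ?N ?N"
    by (simp add: V_def)
  have adjV: "mat_adjoint V = bd 1 (mat_adjoint U3)"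
    unfolding V_def by (simp add: bd_adj)
  have A'bd: "A' = bd e A3"
  proof (rule eq_matI)
    fix i j assume "i < dim_row (bd e A3)" "j < dim_col (bd e A3)"
    then show "A' $$ (i, j) = bd e A3 $$ (i, j)"
      using A'0[of i] A'0'[of j] by (auto simp: bd_def A3_def)
  qed (use carrier_matD[OF A'] carrier_matD[OF A3] in \<open>auto simp: bd_def\<close>)
  have "mat_adjoint V * V = bd 1 (1\<^sub>m n)"
    using U3(1) by (simp add: adjV) (simp add: V_def bd_mult unitary_mat_def)
  also have "\<dots> = 1\<^sub>m ?N"
    by (rule eq_matI) (auto simp: bd_def)
  finally have V: "unitary_mat ?N V" by (simp add: unitary_mat_def)
  have "mat_adjoint (W * V) * A * (W * V) = mat_adjoint V * A' * V"
    unfolding A'_def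
    by (simp add: mat_adjoint_mult[of _ ?N ?N _ ?N] assoc_mult_mat[of _ ?N ?N _ ?N _ ?N])
  also have "\<dots> = bd e (mat_adjoint U3 * A3 * U3)"
    unfolding adjV A'bd unfolding V_def
    by (simp add: bd_mult mult_carrier_mat[of _ n n _ n])
  finally have "diagonal_mat (mat_adjoint (W * V) * A * (W * V))"
    using U3(2) carrier_matD[OF U3c] by (auto simp: bd_def diagonal_mat_def)
  with unitary_mat_mult[OF W V] show ?case by blast
qed

section \<open>Quadratic forms and bounds on the trace norm\<close>

definition quad_form :: "nat \<Rightarrow> (nat \<Rightarrow> nat \<Rightarrow> complex) \<Rightarrow> (nat \<Rightarrow> complex) \<Rightarrow> complex" where
  "quad_form N B u = (\<Sum>i<N. \<Sum>j<N. cnj (u i) * B i j * u j)"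

text \<open>The trace is the same in every orthonormal basis, here the columns of \<open>U\<close>.
  What collapses the double sum is the orthonormality of the rows,
  \<open>U * mat_adjoint U = 1\<close>.\<close>

lemma sum_quad_form_unitary:
  assumes "unitary_mat N U"
  shows "(\<Sum>k<N. quad_form N B (\<lambda>i. U $$ (i, k))) = (\<Sum>i<N. B i i)"
proof -
  note [simp] = carrier_matD[OF unitary_mat_carrier[OF assms]]
  have orth: "(\<Sum>k<N. U $$ (j, k) * cnj (U $$ (i, k))) = (if i = j then 1 else 0)"
    if "i < N" "j < N" for i j
    using arg_cong[OF unitary_mat_right[OF assms], of "\<lambda>M. M $$ (j, i)"] that
    by (simp add: scalar_prod_def mat_adjoint_index atLeast0LessThan)
  have "(\<Sum>k<N. quad_form N B (\<lambda>i. U $$ (i, k)))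
      = (\<Sum>i<N. \<Sum>j<N. \<Sum>k<N. cnj (U $$ (i, k)) * B i j * U $$ (j, k))"
    unfolding quad_form_def
    by (subst sum.swap) (rule sum.cong[OF refl], rule sum.swap)
  also have "\<dots> = (\<Sum>i<N. \<Sum>j<N. B i j * (\<Sum>k<N. U $$ (j, k) * cnj (U $$ (i, k))))"
    by (simp add: sum_distrib_left mult_ac)
  also have "\<dots> = (\<Sum>i<N. \<Sum>j<N. if i = j then B i j else 0)"
    by (intro sum.cong refl) (auto simp: orth)
  finally show ?thesis by simp
qed

lemma proots_linear_factors:
  "proots (\<Prod>a\<leftarrow>as. [:- a, 1:]) = mset (as :: 'a :: idom list)"
proof (induction as)
  case (Cons a as)
  have "(\<Prod>a\<leftarrow>as. [:- a, 1:]) \<noteq> 0"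
    by (auto simp: prod_list_zero_iff)
  then have "proots ([:- a, 1:] * (\<Prod>a\<leftarrow>as. [:- a, 1:])) = {#a#} + mset as"
    by (subst proots_mult) (simp_all add: Cons.IH)
  then show ?case by simp
qed simp

text \<open>Evaluate both forms in an eigenbasis of \<open>A\<close>: the trace norm is at most the
  sum of \<open>|u^* A u|\<close> over the basis, each term is at most \<open>u^* B u\<close>, and
  these add up to the trace of \<open>B\<close>. This does the work of a triangle inequality for the
  trace norm.\<close>

lemma trace_norm_le:
  fixes A :: "complex mat"
  assumes A: "A \<in> carrier_mat N N" "mat_adjoint A = A"
    and bound: "\<And>u. cmod (quad_form N (\<lambda>i j. A $$ (i, j)) u) \<le> Re (quad_form N B u)"
  shows "trace_norm A \<le> Re (\<Sum>i<N. B i i)"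
proof -
  obtain U where U: "unitary_mat N U" "diagonal_mat (mat_adjoint U * A * U)"
    using hermitian_mat_diagonalization[OF A] by blast
  note Uc [simp] = unitary_mat_carrier[OF U(1)]
  note [simp] = A(1) mult_carrier_mat[of _ N N _ N]
  define D where "D = mat_adjoint U * A * U"
  have D [simp]: "D \<in> carrier_mat N N" by (simp add: D_def)
  note [simp] = carrier_matD[OF D] carrier_matD[OF Uc] carrier_matD[OF A(1)]
  have diag: "D $$ (i, j) = 0" if "i < N" "j < N" "i \<noteq> j" for i j
    using U(2) that by (auto simp: D_def diagonal_mat_def)
  have Dquad: "D $$ (k, k) = quad_form N (\<lambda>i j. A $$ (i, j)) (\<lambda>i. U $$ (i, k))" if "k < N" for k
  proof -
    have "D = mat_adjoint U * (A * U)"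
      by (simp add: D_def assoc_mult_mat[of _ N N _ N _ N])
    then show ?thesis
      using that by (simp add: quad_form_def scalar_prod_def mat_adjoint_index atLeast0LessThan
          sum_distrib_left mult_ac)
  qed
  have "U * D * mat_adjoint U = U * mat_adjoint U * A * (U * mat_adjoint U)"
    by (simp add: D_def assoc_mult_mat[of _ N N _ N _ N])
  also have "\<dots> = A"
    using U(1) by (simp add: unitary_mat_right right_mult_one_mat[of _ N N] left_mult_one_mat[of _ N N])
  finally have AD: "A = U * D * mat_adjoint U" ..
  have UU: "mat_adjoint U * U = 1\<^sub>m N" using U(1) by (simp add: unitary_mat_def)
  \<comment> \<open>As \<open>A\<close> is Hermitian, \<open>mat_adjoint A * A\<close> is
    \<open>A * A\<close>, which is similar to \<open>D * D\<close>; so its eigenvalues are the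
    squares of the diagonal entries of \<open>D\<close>.\<close>
  have "A * A = U * D * (mat_adjoint U * U) * D * mat_adjoint U"
    by (subst (1 2) AD) (simp add: assoc_mult_mat[of _ N N _ N _ N])
  also have "\<dots> = U * (D * D) * mat_adjoint U"
    by (simp add: UU right_mult_one_mat[of _ N N] assoc_mult_mat[of _ N N _ N _ N])
  finally have "similar_mat_wit (A * A) (D * D) U (mat_adjoint U)"
    by (intro similar_mat_witI[of _ _ N]) (simp_all add: UU unitary_mat_right[OF U(1)])
  then have char: "char_poly (mat_adjoint A * A) = char_poly (D * D)"
    unfolding A(2) by (intro char_poly_similar) (auto simp: similar_mat_def)
  have DD: "(D * D) $$ (i, j) = (if i = j then (D $$ (i, i))\<^sup>2 else 0)" if "i < N" "j < N" for i j
  proof -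
    have "(D * D) $$ (i, j) = (\<Sum>k<N. D $$ (i, k) * D $$ (k, j))"
      using that by (simp add: scalar_prod_def atLeast0LessThan)
    also have "\<dots> = (\<Sum>k<N. if k = i then D $$ (i, i) * D $$ (i, j) else 0)"
      using that diag by (intro sum.cong) auto
    finally show ?thesis using that diag by (auto simp: power2_eq_square)
  qed
  note char
  also have "char_poly (D * D) = (\<Prod>a\<leftarrow>diag_mat (D * D). [:- a, 1:])"
  proof (rule char_poly_upper_triangular[of _ N])
    have "dim_row (D * D) = N" by simp
    then show "upper_triangular (D * D)"
      using DD by (auto simp del: index_mult_mat)
  qed simp
  also have "diag_mat (D * D) = map (\<lambda>i. (D $$ (i, i))\<^sup>2) [0..<N]"
    using DD by (auto simp: diag_mat_def)
  finally have "proots (char_poly (mat_adjoint A * A))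
      = proots (\<Prod>a\<leftarrow>map (\<lambda>i. (D $$ (i, i))\<^sup>2) [0..<N]. [:- a, 1:])" by simp
  also have "\<dots> = mset (map (\<lambda>i. (D $$ (i, i))\<^sup>2) [0..<N])"
    by (rule proots_linear_factors)
  finally have "trace_norm A = (\<Sum>i<N. sqrt (Re ((D $$ (i, i))\<^sup>2)))"
    by (simp add: trace_norm_def image_mset.compositionality o_def sum_unfold_sum_mset
        atLeast0LessThan[symmetric])
  \<comment> \<open>No appeal to the eigenvalues being real:
    \<open>Re (z\<^sup>2) \<le> |z|\<^sup>2\<close> holds for every complex
    \<open>z\<close>.\<close>
  also have "\<dots> \<le> (\<Sum>i<N. cmod (D $$ (i, i)))"
  proof (intro sum_mono)
    fix i
    have "Re ((D $$ (i, i))\<^sup>2) \<le> (cmod (D $$ (i, i)))\<^sup>2"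
      using complex_Re_le_cmod[of "(D $$ (i, i))\<^sup>2"] by (simp add: norm_power)
    then show "sqrt (Re ((D $$ (i, i))\<^sup>2)) \<le> cmod (D $$ (i, i))"
      by (metis norm_ge_zero real_sqrt_le_mono real_sqrt_unique)
  qed
  also have "\<dots> \<le> (\<Sum>i<N. Re (quad_form N B (\<lambda>j. U $$ (j, i))))"
    using bound by (intro sum_mono) (simp add: Dquad)
  also have "\<dots> = Re (\<Sum>i<N. B i i)"
    by (simp add: Re_sum[symmetric] sum_quad_form_unitary[OF U(1)] del: Re_sum)
  finally show ?thesis .
qed

lemma quad_form_cong:
  "(\<And>i j. i < N \<Longrightarrow> j < N \<Longrightarrow> cnj (u i) * A i j * u j = cnj (w i) * B i j * w j) \<Longrightarrow>
    quad_form N A u = quad_form N B w"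
  unfolding quad_form_def by (intro sum.cong) auto

lemma quad_form_add: "quad_form N (\<lambda>i j. A i j + B i j) u = quad_form N A u + quad_form N B u"
  by (simp add: quad_form_def algebra_simps sum.distrib)

lemma quad_form_diff: "quad_form N (\<lambda>i j. A i j - B i j) u = quad_form N A u - quad_form N B u"
  by (simp add: quad_form_def algebra_simps sum_subtractf)

lemma quad_form_scale: "quad_form N (\<lambda>i j. c * A i j) u = c * quad_form N A u"
  by (simp add: quad_form_def sum_distrib_left mult_ac)

definition compress :: "(nat \<Rightarrow> bool) \<Rightarrow> (nat \<Rightarrow> nat \<Rightarrow> complex) \<Rightarrow> nat \<Rightarrow> nat \<Rightarrow> complex" where
  "compress P A i j = of_bool (P i \<and> P j) * A i j"

text \<open>Compressing the kernel amounts to projecting the vector, so compressions inherit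
  positivity of the form.\<close>

lemma quad_form_compress:
  "quad_form N (compress P A) u = quad_form N A (\<lambda>i. of_bool (P i) * u i)"
  by (rule quad_form_cong) (auto simp: compress_def)

lemma quad_form_block:
  assumes "\<And>i j. i < N \<Longrightarrow> j < N \<Longrightarrow> P i \<noteq> P j \<Longrightarrow> A i j = 0"
  shows "quad_form N A u = quad_form N (compress P A) u + quad_form N (compress (\<lambda>i. \<not> P i) A) u"
  unfolding quad_form_add[symmetric]
  by (rule quad_form_cong) (use assms in \<open>auto simp: compress_def\<close>)

text \<open>On the \<open>P\<close> block the difference is \<open>(1 - c) R\<close>, and on the
  other block positivity bounds it by \<open>R + S\<close>. The kernel \<open>B\<close> adds these
  two bounds, and its trace has three parts, each at most \<open>\<delta>\<close>.\<close>

lemma trace_norm_diff_le: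
  fixes R S :: "nat \<Rightarrow> nat \<Rightarrow> complex"
  assumes psd: "\<And>u. \<exists>r\<ge>0. quad_form N R u = complex_of_real r"
      "\<And>u. \<exists>r\<ge>0. quad_form N S u = complex_of_real r"
    and herm: "\<And>i j. R i j = cnj (R j i)" "\<And>i j. S i j = cnj (S j i)"
    and block: "\<And>i j. i < N \<Longrightarrow> j < N \<Longrightarrow> P i \<noteq> P j \<Longrightarrow> R i j = 0"
      "\<And>i j. i < N \<Longrightarrow> j < N \<Longrightarrow> P i \<noteq> P j \<Longrightarrow> S i j = 0"
    and agree: "\<And>i j. i < N \<Longrightarrow> j < N \<Longrightarrow> P i \<Longrightarrow> P j \<Longrightarrow> S i j = complex_of_real c * R i j"
    and tr: "(\<Sum>i<N. Re (R i i)) = 1" "(\<Sum>i<N. Re (S i i)) = 1"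
    and diag: "\<And>i. Re (R i i) \<ge> 0" "\<And>i. Re (S i i) \<ge> 0"
    and weight: "(\<Sum>i<N. Re (R i i) * of_bool (\<not> P i)) \<le> \<delta>"
      "(\<Sum>i<N. Re (S i i) * of_bool (\<not> P i)) \<le> \<delta>"
  shows "trace_norm (mat N N (\<lambda>(i, j). R i j) - mat N N (\<lambda>(i, j). S i j)) \<le> 3 * \<delta>"
proof -
  let ?Q = "\<lambda>i. \<not> P i"
  define A where "A = mat N N (\<lambda>(i, j). R i j) - mat N N (\<lambda>(i, j). S i j)"
  define B where "B i j = complex_of_real \<bar>1 - c\<bar> * compress P R i j
      + (compress ?Q R i j + compress ?Q S i j)" for i j
  have A: "A \<in> carrier_mat N N" unfolding A_def by (intro minus_carrier_mat) simp
  have idx: "A $$ (i, j) = R i j - S i j" if "i < N" "j < N" for i j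
    using that by (simp add: A_def)
  have "mat_adjoint A = A"
  proof (rule eq_matI)
    fix i j assume "i < dim_row A" "j < dim_col A"
    with A show "mat_adjoint A $$ (i, j) = A $$ (i, j)"
      using herm(1)[of i j] herm(2)[of i j] by (simp add: mat_adjoint_index idx)
  qed (use A in auto)
  moreover have "cmod (quad_form N (\<lambda>i j. A $$ (i, j)) u) \<le> Re (quad_form N B u)" for u
  proof -
    have "quad_form N (compress P S) u = complex_of_real c * quad_form N (compress P R) u"
      unfolding quad_form_scale[symmetric]
      by (rule quad_form_cong) (auto simp: compress_def agree)
    moreover obtain p where p: "p \<ge> 0" "quad_form N (compress P R) u = complex_of_real p"
      using psd(1) unfolding quad_form_compress by blast
    moreover obtain q where q: "q \<ge> 0" "quad_form N (compress ?Q R) u = complex_of_real q"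
      using psd(1) unfolding quad_form_compress by blast
    moreover obtain s where s: "s \<ge> 0" "quad_form N (compress ?Q S) u = complex_of_real s"
      using psd(2) unfolding quad_form_compress by blast
    moreover have "quad_form N (\<lambda>i j. A $$ (i, j)) u = quad_form N R u - quad_form N S u"
      unfolding quad_form_diff[symmetric] by (rule quad_form_cong) (simp add: idx)
    ultimately have "quad_form N (\<lambda>i j. A $$ (i, j)) u = complex_of_real ((1 - c) * p + q - s)"
      using quad_form_block[of N P R u, OF block(1)] quad_form_block[of N P S u, OF block(2)]
      by (simp add: algebra_simps)
    then have "cmod (quad_form N (\<lambda>i j. A $$ (i, j)) u) = \<bar>(1 - c) * p + q - s\<bar>"
      by (simp only: norm_of_real)
    also have "\<dots> \<le> \<bar>1 - c\<bar> * p + q + s"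
      using p(1) q(1) s(1) abs_mult[of "1 - c" p] by linarith
    also have "\<dots> = Re (quad_form N B u)"
      unfolding B_def quad_form_add quad_form_scale using p q s by simp
    finally show ?thesis .
  qed
  ultimately have "trace_norm A \<le> Re (\<Sum>i<N. B i i)"
    by (rule trace_norm_le[OF A])
  also have "\<dots> = \<bar>1 - c\<bar> * (\<Sum>i<N. Re (R i i) * of_bool (P i))
      + ((\<Sum>i<N. Re (R i i) * of_bool (?Q i)) + (\<Sum>i<N. Re (S i i) * of_bool (?Q i)))"
    unfolding Re_sum B_def compress_def sum_distrib_left sum.distrib[symmetric]
    by (intro sum.cong) auto
  \<comment> \<open>By proportionality the left-hand side is the difference of the \<open>P\<close>
    weights of \<open>R\<close> and \<open>S\<close>. Both traces are 1, so it is also the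
    difference of the complementary weights, which both lie between 0 and
    \<open>\<delta>\<close>.\<close>
  also have "\<bar>1 - c\<bar> * (\<Sum>i<N. Re (R i i) * of_bool (P i)) \<le> \<delta>"
  proof -
    have split: "(\<Sum>i<N. f i * of_bool (P i)) + (\<Sum>i<N. f i * of_bool (?Q i)) = (\<Sum>i<N. f i)"
      for f :: "nat \<Rightarrow> real"
      unfolding sum.distrib[symmetric] by (intro sum.cong) auto
    let ?p = "\<Sum>i<N. Re (R i i) * of_bool (P i)" and ?s = "\<Sum>i<N. Re (S i i) * of_bool (P i)"
    have "?s = c * ?p"
      unfolding sum_distrib_left by (intro sum.cong) (auto simp: agree)
    then have "\<bar>1 - c\<bar> * \<bar>?p\<bar> = \<bar>?p - ?s\<bar>"
      by (simp only: abs_mult[symmetric] left_diff_distrib mult_1)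
    moreover have "?p \<ge> 0" "(\<Sum>i<N. Re (R i i) * of_bool (?Q i)) \<ge> 0" "(\<Sum>i<N. Re (S i i) * of_bool (?Q i)) \<ge> 0"
      using diag by (auto intro!: sum_nonneg)
    ultimately show ?thesis
      using split[of "\<lambda>i. Re (R i i)"] split[of "\<lambda>i. Re (S i i)"] tr weight by simp
  qed
  finally show ?thesis using weight by (simp add: A_def)
qed

section \<open>Tensor powers and lists of digits\<close>

text \<open>The leading digit comes first, matching \<open>kronecker\<close>, where the quotient of
  the index belongs to the left factor.\<close>

primrec digits :: "nat \<Rightarrow> nat \<Rightarrow> nat \<Rightarrow> nat list" where
  "digits d 0 i = []"
| "digits d (Suc t) i = (i div d ^ t) # digits d t (i mod d ^ t)"

lemma length_digits [simp]: "length (digits d t i) = t"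
  by (induction t arbitrary: i) auto

lemma set_digits: "i < d ^ t \<Longrightarrow> set (digits d t i) \<subseteq> {..<d}"
proof (induction t arbitrary: i)
  case (Suc t)
  then have "d ^ t > 0" by (cases "d = 0") auto
  with Suc show ?case
    by (auto simp: less_mult_imp_div_less dest!: Suc.IH[of "i mod d ^ t", THEN subsetD, rotated])
qed auto

lemma bij_betw_div_mod:
  assumes "m > 0"
  shows "bij_betw (\<lambda>i. (i div m, i mod m)) {..<d * m} ({..<d} \<times> {..<(m :: nat)})"
proof (rule bij_betw_byWitness[where f' = "\<lambda>(x, j). x * m + j"])
  have "x * m + j < d * m" if "x < d" "j < m" for x j
  proof -
    have "x * m + j < Suc x * m" using that by simp
    also have "\<dots> \<le> d * m" using that by (intro mult_right_mono) auto
    finally show ?thesis .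
  qed
  then show "(\<lambda>(x, j). x * m + j) ` ({..<d} \<times> {..<m}) \<subseteq> {..<d * m}"
    by auto
qed (use assms in \<open>auto simp: less_mult_imp_div_less\<close>)

text \<open>Splits off the leading digit of the index; this is the induction step of the sums over
  digit lists below.\<close>

lemma sum_div_mod:
  fixes f :: "nat \<Rightarrow> nat \<Rightarrow> 'a :: comm_monoid_add"
  assumes "m > 0"
  shows "(\<Sum>i<d * m. f (i div m) (i mod m)) = (\<Sum>x<d. \<Sum>j<m. f x j)"
  using sum.reindex_bij_betw[OF bij_betw_div_mod[OF assms], of "\<lambda>(x, j). f x j" d]
  by (simp add: sum.cartesian_product)

text \<open>Polymorphic because it serves twice: for complex \<open>v\<close> it is a coefficient of
  the product vector, and for a probability vector it is the probability of drawing the list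
  \<open>l\<close> in independent samples.\<close>

definition amplitude :: "(nat \<Rightarrow> 'a :: comm_monoid_mult) \<Rightarrow> nat list \<Rightarrow> 'a" where
  "amplitude v l = prod_list (map v l)"

text \<open>The dimensions are carried through the same induction because \<open>kronecker\<close>
  reads its block size from the right factor.\<close>

lemma tensor_power_ket_bra_index:
  assumes "dim_vec v = d" "i < d ^ t" "j < d ^ t"
  shows "tensor_power (ket_bra v) t \<in> carrier_mat (d ^ t) (d ^ t) \<and>
    tensor_power (ket_bra v) t $$ (i, j) =
      amplitude (($) v) (digits d t i) * cnj (amplitude (($) v) (digits d t j))"
  using assms(2,3)
proof (induction t arbitrary: i j)
  case 0
  then show ?case by (simp add: amplitude_def)
next
  case (Suc t)
  then have "d ^ t > 0" by (cases "d = 0") auto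
  with Suc.prems have "i mod d ^ t < d ^ t" "j mod d ^ t < d ^ t" "i div d ^ t < d" "j div d ^ t < d"
    by (auto simp: less_mult_imp_div_less)
  with Suc.IH[OF this(1,2)] assms(1) Suc.prems show ?case
    by (auto simp: kronecker_def ket_bra_def amplitude_def)
qed

lemma sum_amplitude_digits:
  fixes p :: "nat \<Rightarrow> 'a :: comm_semiring_1"
  assumes "d > 0"
  shows "(\<Sum>i<d ^ t. amplitude p (digits d t i)) = (\<Sum>x<d. p x) ^ t"
proof (induction t)
  case (Suc t)
  have "(\<Sum>i<d ^ Suc t. amplitude p (digits d (Suc t) i))
      = (\<Sum>i<d * d ^ t. p (i div d ^ t) * amplitude p (digits d t (i mod d ^ t)))"
    by (simp add: amplitude_def)
  also have "\<dots> = (\<Sum>x<d. \<Sum>j<d ^ t. p x * amplitude p (digits d t j))"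
    using assms by (intro sum_div_mod) simp
  also have "\<dots> = (\<Sum>x<d. p x) ^ Suc t"
    by (simp add: Suc.IH sum_distrib_left[symmetric] sum_distrib_right[symmetric])
  finally show ?case .
qed (simp add: amplitude_def)

text \<open>Linearity of expectation: each of \<open>t\<close> independent samples from
  \<open>p\<close> equals \<open>y\<close> with probability \<open>p y\<close>.\<close>

lemma sum_amplitude_count:
  fixes p :: "nat \<Rightarrow> real"
  assumes "d > 0" "(\<Sum>x<d. p x) = 1" "y < d"
  shows "(\<Sum>i<d ^ t. amplitude p (digits d t i) * count_list (digits d t i) y) = t * p y"
proof (induction t)
  case (Suc t)
  have one: "(\<Sum>i<d ^ t. amplitude p (digits d t i)) = 1"
    using assms by (simp add: sum_amplitude_digits)
  have "(\<Sum>i<d ^ Suc t. amplitude p (digits d (Suc t) i) * count_list (digits d (Suc t) i) y)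
      = (\<Sum>i<d * d ^ t. p (i div d ^ t) * amplitude p (digits d t (i mod d ^ t)) *
          (of_bool (i div d ^ t = y) + count_list (digits d t (i mod d ^ t)) y))"
    by (intro sum.cong) (auto simp: amplitude_def)
  also have "\<dots> = (\<Sum>x<d. \<Sum>j<d ^ t. p x * amplitude p (digits d t j) *
          (of_bool (x = y) + count_list (digits d t j) y))"
    using assms by (intro sum_div_mod) simp
  also have "\<dots> = (\<Sum>x<d. p x * of_bool (x = y) * (\<Sum>j<d ^ t. amplitude p (digits d t j))
      + p x * (\<Sum>j<d ^ t. amplitude p (digits d t j) * count_list (digits d t j) y))"
    by (simp add: sum_distrib_left sum.distrib algebra_simps)
  also have "\<dots> = (\<Sum>x<d. p x * of_bool (x = y)) + (\<Sum>x<d. p x) * (t * p y)"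
    unfolding one Suc.IH by (simp only: sum.distrib sum_distrib_right mult_1_right)
  also have "(\<Sum>x<d. p x * of_bool (x = y)) + (\<Sum>x<d. p x) * (t * p y)
      = (\<Sum>x<d. if x = y then p x else 0) + (\<Sum>x<d. p x) * (t * p y)"
    by (intro arg_cong2[of _ _ _ _ "(+)"] sum.cong) auto
  also have "\<dots> = Suc t * p y"
    unfolding assms(2) using assms(3) by (simp add: algebra_simps)
  finally show ?case .
qed (simp add: amplitude_def)

text \<open>Birthday bound: the left-hand side is the probability that \<open>t\<close> independent samples from \<open>p\<close>
  are not distinct.\<close>

lemma sum_amplitude_not_distinct_le:
  fixes p :: "nat \<Rightarrow> real"
  assumes "d > 0" "(\<Sum>x<d. p x) = 1" "\<And>x. x < d \<Longrightarrow> p x \<ge> 0"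
  shows "(\<Sum>i<d ^ t. amplitude p (digits d t i) * of_bool (\<not> distinct (digits d t i)))
    \<le> (real t)\<^sup>2 / 2 * (\<Sum>x<d. (p x)\<^sup>2)"
proof (induction t)
  case (Suc t)
  define nd where "nd = (\<Sum>j<d ^ t. amplitude p (digits d t j) * of_bool (\<not> distinct (digits d t j)))"
  have nonneg: "amplitude p (digits d t i) \<ge> 0" if "i < d ^ t" for i
    using set_digits[OF that] assms(3) by (fastforce simp: amplitude_def intro!: prod_list_nonneg)
  have "(\<Sum>i<d ^ Suc t. amplitude p (digits d (Suc t) i) * of_bool (\<not> distinct (digits d (Suc t) i)))
      = (\<Sum>i<d * d ^ t. p (i div d ^ t) * amplitude p (digits d t (i mod d ^ t)) *
          of_bool (i div d ^ t \<in> set (digits d t (i mod d ^ t)) \<or> \<not> distinct (digits d t (i mod d ^ t))))"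
    by (intro sum.cong) (auto simp: amplitude_def)
  also have "\<dots> = (\<Sum>x<d. \<Sum>j<d ^ t. p x * amplitude p (digits d t j) *
          of_bool (x \<in> set (digits d t j) \<or> \<not> distinct (digits d t j)))"
    using assms by (intro sum_div_mod) simp
  \<comment> \<open>Union bound: the chance that the new sample hits an earlier one is at most the
    expected number of hits.\<close>
  also have "\<dots> \<le> (\<Sum>x<d. \<Sum>j<d ^ t. p x * amplitude p (digits d t j) *
          (count_list (digits d t j) x + of_bool (\<not> distinct (digits d t j))))"
  proof (intro sum_mono mult_left_mono)
    fix x j
    have "x \<in> set l \<Longrightarrow> count_list l x \<ge> 1" for l :: "nat list"
      by (metis count_list_0_iff less_one linorder_not_le)
    then show "(of_bool (x \<in> set (digits d t j) \<or> \<not> distinct (digits d t j)) :: real)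
        \<le> count_list (digits d t j) x + of_bool (\<not> distinct (digits d t j))"
      by (cases "x \<in> set (digits d t j)") (auto simp: add_increasing2)
  qed (use assms nonneg in auto)
  also have "\<dots> = (\<Sum>x<d. p x * (\<Sum>j<d ^ t. amplitude p (digits d t j) * count_list (digits d t j) x)
      + p x * nd)"
    unfolding nd_def by (simp only: sum_distrib_left sum.distrib ring_distribs mult.assoc of_nat_add of_nat_of_bool)
  also have "\<dots> = (\<Sum>x<d. p x * (t * p x) +
      p x * nd)"
    using assms by (intro sum.cong refl arg_cong2[of _ _ _ _ "(+)"] arg_cong2[of _ _ _ _ "(*)"]
        sum_amplitude_count) auto
  also have "\<dots> = t * (\<Sum>x<d. (p x)\<^sup>2) +
      nd"
    using assms(2) sum_distrib_right[of p "{..<d}" nd]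
    by (simp add: sum.distrib sum_distrib_left power2_eq_square mult_ac)
  also have "\<dots> \<le> t * (\<Sum>x<d. (p x)\<^sup>2) + (real t)\<^sup>2 / 2 * (\<Sum>x<d. (p x)\<^sup>2)"
    using Suc.IH by (simp add: nd_def)
  also have "\<dots> = (t + (real t)\<^sup>2 / 2) * (\<Sum>x<d. (p x)\<^sup>2)"
    by (simp add: algebra_simps)
  \<comment> \<open>The induction closes because
    \<open>(t + 1)\<^sup>2 = t\<^sup>2 + 2 t + 1\<close>.\<close>
  also have "\<dots> \<le> (real (Suc t))\<^sup>2 / 2 * (\<Sum>x<d. (p x)\<^sup>2)"
    by (intro mult_right_mono sum_nonneg) (auto simp: power2_eq_square field_simps)
  finally show ?case .
qed (simp add: amplitude_def)

section \<open>Moments of random unit vectors\<close>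

lemma amplitude_simps [simp]: "amplitude v [] = 1" "amplitude v (x # l) = v x * amplitude v l"
  by (simp_all add: amplitude_def)

lemma amplitude_cong: "(\<And>x. x \<in> set l \<Longrightarrow> v x = w x) \<Longrightarrow> amplitude v l = amplitude w l"
  unfolding amplitude_def by (simp cong: map_cong)

lemma amplitude_mset_cong: "mset l = mset k \<Longrightarrow> amplitude v l = amplitude v k"
  unfolding amplitude_def by (metis mset_map prod_mset_prod_list)

lemma amplitude_flip:
  fixes v :: "nat \<Rightarrow> 'a :: comm_ring_1"
  shows "amplitude (v(x := - v x)) l = (- 1) ^ count_list l x * amplitude v l"
  by (induction l) auto

lemma amplitude_cmod_square:
  "complex_of_real (amplitude (\<lambda>x. (cmod (v x))\<^sup>2) l) = amplitude v l * cnj (amplitude v l)"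
proof (induction l)
  case (Cons a l)
  then show ?case using complex_norm_square[of "v a"] by (simp add: mult_ac)
qed simp

lemma cmod_amplitude: "cmod (amplitude v l) = amplitude (\<lambda>x. cmod (v x)) l"
  by (induction l) (auto simp: norm_mult)

lemma amplitude_le_1:
  assumes "\<And>x. x \<in> set l \<Longrightarrow> 0 \<le> v x \<and> v x \<le> (1 :: real)"
  shows "0 \<le> amplitude v l \<and> amplitude v l \<le> 1"
  using assms by (induction l) (auto intro: mult_le_one)

text \<open>A label of \<open>l\<close> occurs there exactly once, so by parity it occurs in
  \<open>k\<close> as well. Hence \<open>mset l\<close> is contained in \<open>mset k\<close>, and
  equal lengths force equality.\<close>

lemma even_count_imp_mset_eq:
  assumes "distinct l" "length k = length l" "\<And>x. even (count_list l x + count_list k x)"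
  shows "mset k = mset l"
proof -
  have "count_list l x \<le> count_list k x" for x
  proof -
    have "count_list l x \<le> 1" using assms(1) by (simp add: distinct_count_atmost_1 flip: count_mset)
    with assms(3)[of x] show ?thesis by (cases "count_list l x"; cases "count_list k x") auto
  qed
  then have "mset l \<subseteq># mset k" by (intro mset_subset_eqI) (simp add: count_mset)
  with assms(2) show ?thesis
    by (metis less_irrefl mset_subset_size size_mset subset_mset.le_neq_trans)
qed

text \<open>Common setting for both ensembles. Coordinates are a function of the label, so that sign
  families and vectors are treated alike; normalisation holds almost everywhere, as in
  \<open>haar_state_measure\<close>.\<close>

locale random_unit_vector = prob_space M for M :: "'a measure" +
  fixes d :: nat and X :: "'a \<Rightarrow> nat \<Rightarrow> complex"
  assumes dim_pos: "d > 0"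
    and coord_measurable [measurable]: "\<And>x. x < d \<Longrightarrow> (\<lambda>\<omega>. X \<omega> x) \<in> borel_measurable M"
    and unit: "AE \<omega> in M. (\<Sum>x<d. (cmod (X \<omega> x))\<^sup>2) = 1"
begin

definition moment :: "nat list \<Rightarrow> nat list \<Rightarrow> complex" where
  "moment l k = (\<integral>\<omega>. amplitude (X \<omega>) l * cnj (amplitude (X \<omega>) k) \<partial>M)"

lemma amplitude_measurable:
  "set l \<subseteq> {..<d} \<Longrightarrow> (\<lambda>\<omega>. amplitude (X \<omega>) l) \<in> borel_measurable M"
  by (induction l) auto

text \<open>Coordinates of a unit vector have modulus at most 1. On a probability space this makes
  all moments integrable.\<close>

lemma amplitude_bounded:
  assumes "set l \<subseteq> {..<d}"
  shows "AE \<omega> in M. cmod (amplitude (X \<omega>) l) \<le> 1"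
  using unit
proof eventually_elim
  case (elim \<omega>)
  have "cmod (X \<omega> x) \<le> 1" if "x \<in> set l" for x
  proof -
    have "(cmod (X \<omega> x))\<^sup>2 \<le> (\<Sum>x<d. (cmod (X \<omega> x))\<^sup>2)"
      using that assms by (intro member_le_sum) auto
    with elim show ?thesis by (simp add: abs_square_le_1)
  qed
  then show ?case
    unfolding cmod_amplitude by (intro amplitude_le_1[THEN conjunct2]) simp
qed

lemma moment_integrable:
  assumes "set l \<subseteq> {..<d}" "set k \<subseteq> {..<d}"
  shows "integrable M (\<lambda>\<omega>. amplitude (X \<omega>) l * cnj (amplitude (X \<omega>) k))"
proof (rule integrable_const_bound)
  show "AE \<omega> in M. norm (amplitude (X \<omega>) l * cnj (amplitude (X \<omega>) k)) \<le> 1"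
    using amplitude_bounded[OF assms(1)] amplitude_bounded[OF assms(2)]
    by eventually_elim (simp add: norm_mult mult_le_one)
  show "(\<lambda>\<omega>. amplitude (X \<omega>) l * cnj (amplitude (X \<omega>) k)) \<in> borel_measurable M"
    using measurable_compose[OF amplitude_measurable[OF assms(2)]
        borel_measurable_continuous_onI[of cnj, OF continuous_on_cnj[OF continuous_on_id]]]
    by (intro borel_measurable_times amplitude_measurable assms) (simp add: id_def)
qed

lemma moment_cnj: "moment l k = cnj (moment k l)"
  unfolding moment_def
  by (simp add: mult.commute flip: Bochner_Integration.integral_cnj)

lemma moment_mset_cong: "mset l = mset l' \<Longrightarrow> mset k = mset k' \<Longrightarrow> moment l k = moment l' k'"
  unfolding moment_def using amplitude_mset_cong by metis

lemma moment_diag: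
  "moment l l = complex_of_real (\<integral>\<omega>. amplitude (\<lambda>x. (cmod (X \<omega> x))\<^sup>2) l \<partial>M)"
  unfolding moment_def amplitude_cmod_square[symmetric] by simp

text \<open>The matrix entries of the averaged \<open>t\<close>-fold state in the computational
  basis.\<close>

definition tensor_moment :: "nat \<Rightarrow> nat \<Rightarrow> nat \<Rightarrow> complex" where
  "tensor_moment t i j = moment (digits d t i) (digits d t j)"

text \<open>The form at \<open>u\<close> is the expected squared modulus of the overlap of
  \<open>u\<close> with the product vector.\<close>

lemma quad_form_tensor_moment:
  "\<exists>r\<ge>0. quad_form (d ^ t) (tensor_moment t) u = complex_of_real r"
proof (intro exI conjI)
  let ?f = "\<lambda>\<omega> i. amplitude (X \<omega>) (digits d t i)"
  have int: "integrable M (\<lambda>\<omega>. cnj (u i) * (?f \<omega> i * cnj (?f \<omega> j)) * u j)"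
    if "i < d ^ t" "j < d ^ t" for i j
    using that by (intro integrable_mult_left integrable_mult_right moment_integrable set_digits)
  have "quad_form (d ^ t) (tensor_moment t) u
      = (\<Sum>i<d ^ t. \<Sum>j<d ^ t. \<integral>\<omega>. cnj (u i) * (?f \<omega> i * cnj (?f \<omega> j)) * u j \<partial>M)"
    by (simp add: quad_form_def tensor_moment_def moment_def)
  also have "\<dots> = (\<Sum>i<d ^ t. \<integral>\<omega>. (\<Sum>j<d ^ t. cnj (u i) * (?f \<omega> i * cnj (?f \<omega> j)) * u j) \<partial>M)"
    by (intro sum.cong refl Bochner_Integration.integral_sum[symmetric] int) auto
  also have "\<dots> = (\<integral>\<omega>. (\<Sum>i<d ^ t. \<Sum>j<d ^ t. cnj (u i) * (?f \<omega> i * cnj (?f \<omega> j)) * u j) \<partial>M)"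
    by (intro Bochner_Integration.integral_sum[symmetric] Bochner_Integration.integrable_sum int) auto
  also have "\<dots> = (\<integral>\<omega>. complex_of_real ((cmod (\<Sum>i<d ^ t. cnj (u i) * ?f \<omega> i))\<^sup>2) \<partial>M)"
    unfolding complex_norm_square cnj_sum sum_product
    by (intro Bochner_Integration.integral_cong sum.cong refl) simp
  also have "\<dots> = complex_of_real (\<integral>\<omega>. (cmod (\<Sum>i<d ^ t. cnj (u i) * ?f \<omega> i))\<^sup>2 \<partial>M)"
    by (rule integral_complex_of_real)
  finally show "quad_form (d ^ t) (tensor_moment t) u = \<dots>" .
qed simp

lemma tensor_moment_diag:
  "tensor_moment t i i = complex_of_real (\<integral>\<omega>. amplitude (\<lambda>x. (cmod (X \<omega> x))\<^sup>2) (digits d t i) \<partial>M)"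
  by (simp add: tensor_moment_def moment_diag)

lemma prob_integrable:
  assumes "set l \<subseteq> {..<d}"
  shows "integrable M (\<lambda>\<omega>. amplitude (\<lambda>x. (cmod (X \<omega> x))\<^sup>2) l)"
  using integrable_Re[OF moment_integrable[OF assms assms]]
  by (simp flip: amplitude_cmod_square)

lemma trace_tensor_moment: "(\<Sum>i<d ^ t. Re (tensor_moment t i i)) = 1"
proof -
  have "(\<Sum>i<d ^ t. Re (tensor_moment t i i))
      = (\<integral>\<omega>. (\<Sum>i<d ^ t. amplitude (\<lambda>x. (cmod (X \<omega> x))\<^sup>2) (digits d t i)) \<partial>M)"
    by (simp add: tensor_moment_diag prob_integrable set_digits)
  also have "\<dots> = (\<integral>\<omega>. 1 \<partial>M)"
    using unit
    by (intro integral_cong_AE) (auto simp: sum_amplitude_digits dim_pos elim!: eventually_mono)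
  finally show ?thesis by (simp add: prob_space)
qed

lemma tensor_moment_diag_nonneg: "Re (tensor_moment t i i) \<ge> 0"
  unfolding tensor_moment_diag
  by (auto simp: amplitude_def intro!: Bochner_Integration.integral_nonneg prod_list_nonneg)

text \<open>For almost every outcome the squared moduli form a probability vector; apply the
  birthday bound to it and integrate.\<close>

lemma collision_tensor_moment:
  "(\<Sum>i<d ^ t. Re (tensor_moment t i i) * of_bool (\<not> distinct (digits d t i)))
    \<le> (real t)\<^sup>2 / 2 * (\<integral>\<omega>. (\<Sum>x<d. (cmod (X \<omega> x)) ^ 4) \<partial>M)"
proof -
  have int: "integrable M (\<lambda>\<omega>. (cmod (X \<omega> x)) ^ 4)" if "x < d" for x
    using prob_integrable[of "[x, x]"] that by (simp flip: power_add add: power4_eq_xxxx power2_eq_square mult.assoc)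
  have "(\<Sum>i<d ^ t. Re (tensor_moment t i i) * of_bool (\<not> distinct (digits d t i)))
      = (\<integral>\<omega>. (\<Sum>i<d ^ t. amplitude (\<lambda>x. (cmod (X \<omega> x))\<^sup>2) (digits d t i) *
          of_bool (\<not> distinct (digits d t i))) \<partial>M)"
    by (simp add: tensor_moment_diag prob_integrable set_digits)
  also have "\<dots> \<le> (\<integral>\<omega>. (real t)\<^sup>2 / 2 * (\<Sum>x<d. (cmod (X \<omega> x)) ^ 4) \<partial>M)"
  proof (rule integral_mono_AE)
    show "AE \<omega> in M. (\<Sum>i<d ^ t. amplitude (\<lambda>x. (cmod (X \<omega> x))\<^sup>2) (digits d t i) *
          of_bool (\<not> distinct (digits d t i))) \<le> (real t)\<^sup>2 / 2 * (\<Sum>x<d. (cmod (X \<omega> x)) ^ 4)"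
      using unit
    proof eventually_elim
      case (elim \<omega>)
      from sum_amplitude_not_distinct_le[OF dim_pos elim, of t] show ?case
        by (simp flip: power_mult)
    qed
    show "integrable M (\<lambda>\<omega>. (real t)\<^sup>2 / 2 * (\<Sum>x<d. (cmod (X \<omega> x)) ^ 4))"
      by (intro integrable_mult_right Bochner_Integration.integrable_sum int) auto
  qed (intro Bochner_Integration.integrable_sum integrable_mult_left prob_integrable set_digits, simp)
  also have "\<dots> = (real t)\<^sup>2 / 2 * (\<integral>\<omega>. (\<Sum>x<d. (cmod (X \<omega> x)) ^ 4) \<partial>M)"
    by simp
  finally show ?thesis .
qed

end

text \<open>The symmetry is recorded through its effect on moments rather than on laws, so that each
  ensemble can derive it by a change of variables in its own probability space.\<close>

locale sign_invariant_vector = random_unit_vector +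
  assumes odd_moment: "\<And>x l k. x < d \<Longrightarrow> set l \<subseteq> {..<d} \<Longrightarrow> set k \<subseteq> {..<d} \<Longrightarrow>
    odd (count_list l x + count_list k x) \<Longrightarrow> moment l k = 0"
begin

lemma moment_distinct:
  assumes "distinct l" "length k = length l" "set l \<subseteq> {..<d}" "set k \<subseteq> {..<d}"
  shows "moment l k = (if mset k = mset l then moment l l else 0)"
proof (cases "mset k = mset l")
  case False
  then obtain x where x: "odd (count_list l x + count_list k x)"
    using even_count_imp_mset_eq[OF assms(1,2)] by blast
  then have "x \<in> set l \<union> set k"
    by (cases "x \<in> set l"; cases "x \<in> set k") (auto simp: count_list_0_iff[THEN iffD2])
  then have "x < d" using assms(3,4) by auto
  with False x assms(3,4) show ?thesis by (simp add: odd_moment)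
qed (auto intro: moment_mset_cong)

end

text \<open>Takes \<open>P i\<close> to be distinctness of the digits. A distinct list is never a
  permutation of one with repetitions, which gives the block structure; within the distinct block
  all entries reduce to diagonal moments, where \<open>agree\<close> applies.\<close>

lemma trace_norm_tensor_moment_diff_le:
  assumes R: "sign_invariant_vector M d X" and S: "sign_invariant_vector M' d X'"
    and agree: "\<And>l. distinct l \<Longrightarrow> set l \<subseteq> {..<d} \<Longrightarrow> length l = t \<Longrightarrow>
      random_unit_vector.moment M' X' l l = complex_of_real c * random_unit_vector.moment M X l l"
    and fourth: "(\<integral>\<omega>. (\<Sum>x<d. (cmod (X \<omega> x)) ^ 4) \<partial>M) \<le> \<epsilon>"
      "(\<integral>\<omega>. (\<Sum>x<d. (cmod (X' \<omega> x)) ^ 4) \<partial>M') \<le> \<epsilon>"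
  shows "trace_norm
    (mat (d ^ t) (d ^ t) (\<lambda>(i, j). random_unit_vector.tensor_moment M d X t i j)
      - mat (d ^ t) (d ^ t) (\<lambda>(i, j). random_unit_vector.tensor_moment M' d X' t i j))
    \<le> 3 * ((real t)\<^sup>2 / 2 * \<epsilon>)"
proof -
  interpret R: sign_invariant_vector M d X by fact
  interpret S: sign_invariant_vector M' d X' by fact
  let ?P = "\<lambda>i. distinct (digits d t i)"
  have mset: "mset (digits d t j) \<noteq> mset (digits d t i)" if "?P i" "\<not> ?P j" for i j
    using that by (metis mset_eq_imp_distinct_iff)
  have herm: "R.tensor_moment t i j = cnj (R.tensor_moment t j i)"
    "S.tensor_moment t i j = cnj (S.tensor_moment t j i)" for i j
    unfolding R.tensor_moment_def S.tensor_moment_def by (rule R.moment_cnj S.moment_cnj)+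
  have off: "R.tensor_moment t i j = 0" "S.tensor_moment t i j = 0"
    if "i < d ^ t" "j < d ^ t" "?P i" "\<not> ?P j" for i j
    using that mset[of i j] R.moment_distinct[of "digits d t i" "digits d t j"]
      S.moment_distinct[of "digits d t i" "digits d t j"] set_digits
    by (simp_all add: R.tensor_moment_def S.tensor_moment_def)
  have block: "R.tensor_moment t i j = 0" "S.tensor_moment t i j = 0"
    if "i < d ^ t" "j < d ^ t" "?P i \<noteq> ?P j" for i j
    using that off[of i j] off[of j i] herm[of i j] by auto
  have fac: "(real t)\<^sup>2 / 2 * a \<le> (real t)\<^sup>2 / 2 * \<epsilon>" if "a \<le> \<epsilon>" for a
    using that by (intro mult_left_mono) auto
  show ?thesis
  proof (rule trace_norm_diff_le[where P = ?P and c = c])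
    show "S.tensor_moment t i j = complex_of_real c * R.tensor_moment t i j"
      if "i < d ^ t" "j < d ^ t" "?P i" "?P j" for i j
      using that agree[of "digits d t i"] set_digits
        R.moment_distinct[of "digits d t i" "digits d t j"] S.moment_distinct[of "digits d t i" "digits d t j"]
      by (simp add: R.tensor_moment_def S.tensor_moment_def)
    show "(\<Sum>i<d ^ t. Re (R.tensor_moment t i i) * of_bool (\<not> ?P i)) \<le> (real t)\<^sup>2 / 2 * \<epsilon>"
      using R.collision_tensor_moment[of t] fac[OF fourth(1)] by (rule order_trans)
    show "(\<Sum>i<d ^ t. Re (S.tensor_moment t i i) * of_bool (\<not> ?P i)) \<le> (real t)\<^sup>2 / 2 * \<epsilon>"
      using S.collision_tensor_moment[of t] fac[OF fourth(2)] by (rule order_trans)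
    show "R.tensor_moment t i j = cnj (R.tensor_moment t j i)"
      "S.tensor_moment t i j = cnj (S.tensor_moment t j i)" for i j
      by (fact herm)+
  qed (use block in \<open>simp_all add: R.quad_form_tensor_moment S.quad_form_tensor_moment
        R.trace_tensor_moment S.trace_tensor_moment
        R.tensor_moment_diag_nonneg S.tensor_moment_diag_nonneg\<close>)
qed

section \<open>Random signs\<close>

definition sign_vector :: "nat \<Rightarrow> (nat \<Rightarrow> real) \<Rightarrow> nat \<Rightarrow> complex" where
  "sign_vector d \<alpha> x = complex_of_real (\<alpha> x / sqrt d)"

lemma random_signs_eq:
  "random_signs d = pmf_of_set (PiE_dflt {..<d} 1 (\<lambda>_. {- 1, 1}))"
  unfolding random_signs_def by (intro Pi_pmf_of_set) auto

lemma finite_signs: "finite (PiE_dflt {..<d :: nat} (1 :: real) (\<lambda>_. {- 1, 1}))"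
  by (intro finite_PiE_dflt) auto

lemma signs_nonempty: "PiE_dflt {..<d :: nat} (1 :: real) (\<lambda>_. {- 1, 1}) \<noteq> {}"
  by (auto simp: PiE_dflt_def intro!: exI[of _ "\<lambda>_. 1"])

lemma set_random_signs: "set_pmf (random_signs d) = PiE_dflt {..<d} 1 (\<lambda>_. {- 1, 1})"
  unfolding random_signs_eq by (rule set_pmf_of_set[OF signs_nonempty finite_signs])

text \<open>The flip is an involution of the finite set on which \<open>random_signs d\<close> is
  uniform.\<close>

lemma random_signs_flip:
  assumes "x < d"
  shows "map_pmf (\<lambda>\<alpha>. \<alpha>(x := - \<alpha> x)) (random_signs d) = random_signs d"
proof -
  let ?A = "PiE_dflt {..<d} (1 :: real) (\<lambda>_. {- 1, 1})" and ?f = "\<lambda>\<alpha> :: nat \<Rightarrow> real. \<alpha>(x := - \<alpha> x)"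
  \<comment> \<open>Here \<open>x < d\<close> matters: beyond \<open>d\<close> the default value 1
    must not be flipped.\<close>
  have sub: "?f \<alpha> \<in> ?A" if "\<alpha> \<in> ?A" for \<alpha>
    using that assms by (auto simp: PiE_dflt_def)
  have inv: "?f (?f \<alpha>) = \<alpha>" for \<alpha> by auto
  have "\<alpha> \<in> ?f ` ?A" if "\<alpha> \<in> ?A" for \<alpha>
    using inv[of \<alpha>, symmetric] sub[OF that] by (rule image_eqI)
  then have "?f ` ?A = ?A"
    using sub by blast
  moreover have "inj_on ?f ?A" by (rule inj_on_inverseI[where g = ?f]) (rule inv)
  ultimately show ?thesis
    unfolding random_signs_eq by (simp add: map_pmf_of_set_inj signs_nonempty finite_signs)
qed

text \<open>Only the signs are random, not the moduli; the diagonal and fourth moments below are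
  therefore expectations of constants.\<close>

lemma cmod_sign_vector:
  assumes "\<alpha> \<in> set_pmf (random_signs d)" "x < d"
  shows "(cmod (sign_vector d \<alpha> x))\<^sup>2 = 1 / d"
proof -
  have "\<bar>\<alpha> x\<bar> = 1" using assms by (auto simp: set_random_signs PiE_dflt_def)
  then show ?thesis by (simp add: sign_vector_def norm_divide power_divide)
qed

lemma sign_vector_unit:
  assumes "d > 0"
  shows "random_unit_vector (measure_pmf (random_signs d)) d (sign_vector d)"
proof (rule random_unit_vector.intro[OF measure_pmf.prob_space_axioms], unfold_locales)
  show "AE \<alpha> in measure_pmf (random_signs d). (\<Sum>x<d. (cmod (sign_vector d \<alpha> x))\<^sup>2) = 1"
    using assms by (intro AE_pmfI) (simp add: cmod_sign_vector)
qed (use assms in auto)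

lemma sign_vector_invariant:
  assumes "d > 0"
  shows "sign_invariant_vector (measure_pmf (random_signs d)) d (sign_vector d)"
proof -
  interpret random_unit_vector "measure_pmf (random_signs d)" d "sign_vector d"
    using assms by (rule sign_vector_unit)
  show ?thesis
  proof unfold_locales
    fix x l k assume x: "x < d" and odd: "odd (count_list l x + count_list k x)"
    have flip: "sign_vector d (\<alpha>(x := - \<alpha> x)) = (sign_vector d \<alpha>)(x := - sign_vector d \<alpha> x)" for \<alpha>
      by (auto simp: sign_vector_def)
    \<comment> \<open>Substituting the flipped signs multiplies the integrand by -1 to an odd power,
      so the moment equals its own negative.\<close>
    have "moment l k = (\<integral>\<alpha>. amplitude (sign_vector d \<alpha>) l * cnj (amplitude (sign_vector d \<alpha>) k)
        \<partial>measure_pmf (map_pmf (\<lambda>\<alpha>. \<alpha>(x := - \<alpha> x)) (random_signs d)))"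
      by (simp add: moment_def random_signs_flip[OF x])
    also have "\<dots> = (- 1) ^ (count_list l x + count_list k x) * moment l k"
      unfolding integral_map_pmf flip amplitude_flip moment_def
      by (simp add: power_add mult_ac flip: Bochner_Integration.integral_mult_right_zero)
    finally show "moment l k = 0" using odd by simp
  qed
qed

lemma sign_vector_moment:
  assumes "d > 0" "set l \<subseteq> {..<d}"
  shows "random_unit_vector.moment (measure_pmf (random_signs d)) (sign_vector d) l l
    = complex_of_real ((1 / d) ^ length l)"
proof -
  interpret random_unit_vector "measure_pmf (random_signs d)" d "sign_vector d"
    using assms(1) by (rule sign_vector_unit)
  have "amplitude (\<lambda>x. (cmod (sign_vector d \<alpha> x))\<^sup>2) l = (1 / d) ^ length l"
    if "\<alpha> \<in> set_pmf (random_signs d)" for \<alpha>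
    using assms(2) by (induction l) (auto simp: cmod_sign_vector[OF that])
  then have "(\<integral>\<alpha>. amplitude (\<lambda>x. (cmod (sign_vector d \<alpha> x))\<^sup>2) l \<partial>measure_pmf (random_signs d))
      = (\<integral>\<alpha>. (1 / d) ^ length l \<partial>measure_pmf (random_signs d))"
    by (intro integral_cong_AE AE_pmfI) auto
  then show ?thesis by (simp add: moment_diag)
qed

lemma sign_vector_fourth_moment:
  assumes "d > 0"
  shows "(\<integral>\<alpha>. (\<Sum>x<d. (cmod (sign_vector d \<alpha> x)) ^ 4) \<partial>measure_pmf (random_signs d)) = 1 / d"
proof -
  have "(cmod (sign_vector d \<alpha> x)) ^ 4 = (1 / d)\<^sup>2" if "\<alpha> \<in> set_pmf (random_signs d)" "x < d" for \<alpha> x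
    using cmod_sign_vector[OF that] power_mult[of "cmod (sign_vector d \<alpha> x)" 2 2] by simp
  then have "(\<integral>\<alpha>. (\<Sum>x<d. (cmod (sign_vector d \<alpha> x)) ^ 4) \<partial>measure_pmf (random_signs d))
      = (\<integral>\<alpha>. 1 / d \<partial>measure_pmf (random_signs d))"
    using assms by (intro integral_cong_AE AE_pmfI) (auto simp: power2_eq_square)
  then show ?thesis by simp
qed

section \<open>Haar-random states\<close>

locale haar_state =
  fixes d :: nat and \<mu> :: "complex vec measure"
  assumes haar: "haar_state_measure d \<mu>" and pos: "d > 0"
begin

sublocale prob_space \<mu>
  using haar by (simp add: haar_state_measure_def)

lemma sets_haar: "sets \<mu> = sets (borel_vec d)"
  using haar by (simp add: haar_state_measure_def)

lemma space_haar: "space \<mu> = carrier_vec d"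
  using sets_eq_imp_space_eq[OF sets_haar] by (simp add: borel_vec_def)

lemma coord_measurable: "x < d \<Longrightarrow> (\<lambda>v. v $ x) \<in> borel_measurable \<mu>"
proof -
  assume x: "x < d"
  have "(\<lambda>v. \<lambda>i\<in>{..<d}. v $ i) \<in> borel_vec d \<rightarrow>\<^sub>M (\<Pi>\<^sub>M i\<in>{..<d}. borel)"
    unfolding borel_vec_def by (rule measurable_vimage_algebra1) (auto simp: space_PiM)
  then have "(\<lambda>v. \<lambda>i\<in>{..<d}. v $ i) \<in> \<mu> \<rightarrow>\<^sub>M (\<Pi>\<^sub>M i\<in>{..<d}. borel)"
    using measurable_cong_sets[OF sets_haar refl] by blast
  from measurable_compose[OF this measurable_component_singleton[of x]] x show ?thesis
    by simp
qed

lemma mult_mat_vec_index: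
  assumes "U \<in> carrier_mat d d" "v \<in> carrier_vec d" "i < d"
  shows "(U *\<^sub>v v) $ i = (\<Sum>j<d. U $$ (i, j) * v $ j)"
  using assms by (auto simp: scalar_prod_def atLeast0LessThan intro!: sum.cong)

text \<open>Turns invariance of \<open>distr\<close> into a change of variables. Each coordinate of
  \<open>U *\<^sub>v v\<close> is a finite linear combination of measurable ones.\<close>

lemma mult_measurable:
  assumes U: "U \<in> carrier_mat d d"
  shows "(\<lambda>v. U *\<^sub>v v) \<in> \<mu> \<rightarrow>\<^sub>M \<mu>"
proof -
  have "(\<lambda>v. U *\<^sub>v v) \<in> \<mu> \<rightarrow>\<^sub>M borel_vec d"
    unfolding borel_vec_def
  proof (rule measurable_vimage_algebra2)
    show "(\<lambda>v. U *\<^sub>v v) \<in> space \<mu> \<rightarrow> carrier_vec d"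
      using U by (auto simp: space_haar)
    have "(\<lambda>v. (U *\<^sub>v v) $ i) \<in> borel_measurable \<mu>" if "i < d" for i
    proof -
      have "(\<lambda>v. \<Sum>j<d. U $$ (i, j) * v $ j) \<in> borel_measurable \<mu>"
        by (intro borel_measurable_sum borel_measurable_times borel_measurable_const coord_measurable) simp
      then show ?thesis
        using measurable_cong[of \<mu> "\<lambda>v. (U *\<^sub>v v) $ i" "\<lambda>v. \<Sum>j<d. U $$ (i, j) * v $ j" borel]
          mult_mat_vec_index[OF U _ that] by (simp add: space_haar)
    qed
    then show "(\<lambda>v. \<lambda>i\<in>{..<d}. (U *\<^sub>v v) $ i) \<in> \<mu> \<rightarrow>\<^sub>M (\<Pi>\<^sub>M i\<in>{..<d}. borel)"
      by (intro measurable_restrict) auto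
  qed
  then show ?thesis using measurable_cong_sets[OF refl sets_haar] by blast
qed

lemma integral_unitary:
  fixes g :: "complex vec \<Rightarrow> 'b :: {banach, second_countable_topology}"
  assumes U: "unitary_mat d U" and g: "g \<in> borel_measurable \<mu>"
  shows "(\<integral>v. g (U *\<^sub>v v) \<partial>\<mu>) = (\<integral>v. g v \<partial>\<mu>)"
proof -
  have "distr \<mu> \<mu> (\<lambda>v. U *\<^sub>v v) = \<mu>"
    using haar U by (simp add: haar_state_measure_def)
  with integral_distr[OF mult_measurable[OF unitary_mat_carrier[OF U]] g] show ?thesis
    by simp
qed

sublocale random_unit_vector \<mu> d "\<lambda>v x. v $ x"
proof unfold_locales
  have "AE v in \<mu>. v \<in> carrier_vec d" using AE_space[of \<mu>] by (simp add: space_haar)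
  moreover have "AE v in \<mu>. v \<bullet>c v = 1" using haar by (simp add: haar_state_measure_def)
  ultimately show "AE v in \<mu>. (\<Sum>x<d. (cmod (v $ x))\<^sup>2) = 1"
  proof eventually_elim
    case (elim v)
    then have "complex_of_real (\<Sum>x<d. (cmod (v $ x))\<^sup>2) = 1"
      by (simp add: scalar_prod_def atLeast0LessThan of_real_sum complex_norm_square del: of_real_power)
    then show ?case using of_real_eq_1_iff by blast
  qed
qed (fact pos coord_measurable)+

end

section \<open>Explicit unitaries and auxiliary identities for the Haar moments\<close>

definition monomial_mat :: "nat \<Rightarrow> (nat \<Rightarrow> nat) \<Rightarrow> (nat \<Rightarrow> complex) \<Rightarrow> complex mat" where
  "monomial_mat d \<pi> a = mat d d (\<lambda>(i, j). if j = \<pi> i then a i else 0)"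

text \<open>Every row and every column has a single entry, of modulus 1. These matrices supply sign
  flips and phases (\<open>\<pi> = id\<close>) and relabelings (\<open>a = 1\<close>).\<close>

lemma unitary_monomial_mat:
  assumes "\<pi> permutes {..<d}" "\<And>i. i < d \<Longrightarrow> cmod (a i) = 1"
  shows "unitary_mat d (monomial_mat d \<pi> a)"
proof -
  let ?U = "monomial_mat d \<pi> a"
  have "(mat_adjoint ?U * ?U) $$ (i, j) = 1\<^sub>m d $$ (i, j)" if "i < d" "j < d" for i j
  proof -
    have "(mat_adjoint ?U * ?U) $$ (i, j)
        = (\<Sum>k<d. cnj (if i = \<pi> k then a k else 0) * (if j = \<pi> k then a k else 0))"
      using that by (simp add: monomial_mat_def scalar_prod_def mat_adjoint_index atLeast0LessThan)
    also have "\<dots> = (\<Sum>k<d. if \<pi> k = i \<and> \<pi> k = j then 1 else 0)"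
      using assms(2) by (intro sum.cong) (auto simp: complex_norm_square[symmetric] mult.commute)
    also have "\<dots> = (\<Sum>k<d. if k = i \<and> k = j then 1 else 0)"
      using sum.permute[OF assms(1), of "\<lambda>k. if k = i \<and> k = j then 1 else (0 :: complex)"] by (simp add: o_def)
    finally show ?thesis using that by auto
  qed
  then show ?thesis
    unfolding unitary_mat_def by (auto simp: monomial_mat_def intro!: eq_matI)
qed

text \<open>A Hadamard gate on the plane spanned by the basis vectors \<open>x\<close> and
  \<open>y\<close>, and the identity elsewhere.\<close>

definition mixing_mat :: "nat \<Rightarrow> nat \<Rightarrow> nat \<Rightarrow> complex mat" where
  "mixing_mat d x y = mat d d (\<lambda>(i, j).
     if i = x then (of_bool (j = x) + of_bool (j = y)) / complex_of_real (sqrt 2)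
     else if i = y then (of_bool (j = x) - of_bool (j = y)) / complex_of_real (sqrt 2)
     else of_bool (j = i))"

lemma mixing_mat_sum:
  assumes "x < d" "y < d" "i < d"
  shows "(\<Sum>j<d. mixing_mat d x y $$ (i, j) * f j) =
     (if i = x then (f x + f y) / complex_of_real (sqrt 2)
      else if i = y then (f x - f y) / complex_of_real (sqrt 2) else f i)"
proof -
  have pick: "(\<Sum>j<d. of_bool (j = z) * f j) = f z" if "z < d" for z
    using that by (simp add: of_bool_def if_distrib[of "\<lambda>c. c * _"] cong: if_cong)
  show ?thesis
    using assms pick
    by (simp add: mixing_mat_def add_divide_distrib diff_divide_distrib ring_distribs sum.distrib
        sum_subtractf flip: sum_divide_distrib)
qed

lemma unitary_mixing_mat:
  assumes "x < d" "y < d" "x \<noteq> y"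
  shows "unitary_mat d (mixing_mat d x y)"
proof -
  let ?U = "mixing_mat d x y"
  have s: "complex_of_real (sqrt 2) * complex_of_real (sqrt 2) = 2"
    by (simp flip: of_real_mult)
  have "(mat_adjoint ?U * ?U) $$ (i, j) = 1\<^sub>m d $$ (i, j)" if "i < d" "j < d" for i j
  proof -
    \<comment> \<open>The matrix is real and symmetric, so unitarity means that it squares to the
      identity, which the row formula evaluates.\<close>
    have "cnj (?U $$ (k, i)) = ?U $$ (i, k)" if "k < d" for k
      using that \<open>i < d\<close> assms by (auto simp: mixing_mat_def)
    then have "(mat_adjoint ?U * ?U) $$ (i, j) = (\<Sum>k<d. ?U $$ (i, k) * ?U $$ (k, j))"
      using that by (simp add: mixing_mat_def scalar_prod_def mat_adjoint_index atLeast0LessThan)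
    also have "\<dots> = 1\<^sub>m d $$ (i, j)"
      using that assms unfolding mixing_mat_sum[OF assms(1,2) that(1)]
      by (auto simp: mixing_mat_def s add_divide_distrib[symmetric] diff_divide_distrib[symmetric])
    finally show ?thesis .
  qed
  then show ?thesis
    unfolding unitary_mat_def by (auto simp: mixing_mat_def intro!: eq_matI)
qed

text \<open>Appending the missing labels to \<open>l\<close> lists all of \<open>{..<d}\<close>
  once; the permutation reads off that list.\<close>

lemma distinct_list_extends_to_permutation:
  assumes "distinct l" "set l \<subseteq> {..<d}"
  obtains \<pi> where "\<pi> permutes {..<d}" "l = map \<pi> [0..<length l]"
proof -
  define L where "L = l @ sorted_list_of_set ({..<d} - set l)"
  have L: "distinct L" "set L = {..<d}" using assms by (auto simp: L_def)
  then have len: "length L = d" using distinct_card[of L] by simp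
  define \<pi> where "\<pi> i = (if i < d then L ! i else i)" for i
  have "bij_betw (\<lambda>i. L ! i) {..<d} {..<d}"
    using bij_betw_nth[OF L(1)] L(2) len by blast
  then have "bij_betw \<pi> {..<d} {..<d}"
    by (rule bij_betw_cong[THEN iffD1, rotated]) (simp add: \<pi>_def)
  then have "\<pi> permutes {..<d}"
    by (rule bij_imp_permutes) (simp add: \<pi>_def)
  moreover have "l = map \<pi> [0..<length l]"
    using len by (intro nth_equalityI) (auto simp: \<pi>_def L_def nth_append)
  ultimately show thesis by (rule that)
qed

text \<open>Summing \<open>|a + w b|^4\<close> over the fourth roots of unity \<open>w\<close>
  cancels every term with a net phase in \<open>w\<close>.\<close>

lemma sum_phases_fourth_power:
  "cmod (a + b) ^ 4 + cmod (a - b) ^ 4 + cmod (a + \<i> * b) ^ 4 + cmod (a - \<i> * b) ^ 4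
    = 4 * cmod a ^ 4 + 4 * cmod b ^ 4 + 16 * (cmod a)\<^sup>2 * (cmod b)\<^sup>2"
proof -
  have fourth: "cmod z ^ 4 = ((Re z)\<^sup>2 + (Im z)\<^sup>2)\<^sup>2" for z
    using power_mult[of "cmod z" 2 2] by (simp add: cmod_power2)
  show ?thesis
    unfolding fourth cmod_power2 by (simp add: power2_eq_square algebra_simps)
qed

section \<open>Consequences of unitary invariance\<close>

context haar_state
begin

lemma monomial_mult_index:
  assumes "\<pi> permutes {..<d}" "v \<in> carrier_vec d" "i < d"
  shows "(monomial_mat d \<pi> a *\<^sub>v v) $ i = a i * v $ \<pi> i"
proof -
  have "\<pi> i < d" using permutes_in_image[OF assms(1), of i] assms(3) by simp
  have "(monomial_mat d \<pi> a *\<^sub>v v) $ i = (\<Sum>j<d. monomial_mat d \<pi> a $$ (i, j) * v $ j)"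
    using assms by (intro mult_mat_vec_index) (auto simp: monomial_mat_def)
  also have "\<dots> = (\<Sum>j<d. if j = \<pi> i then a i * v $ j else 0)"
    using assms(3) by (intro sum.cong) (auto simp: monomial_mat_def)
  finally have "(monomial_mat d \<pi> a *\<^sub>v v) $ i = (\<Sum>j<d. if j = \<pi> i then a i * v $ j else 0)" .
  with \<open>\<pi> i < d\<close> show ?thesis by simp
qed

lemma moment_monomial:
  assumes \<pi>: "\<pi> permutes {..<d}" and a: "\<And>i. i < d \<Longrightarrow> cmod (a i) = 1"
    and l: "set l \<subseteq> {..<d}" "set k \<subseteq> {..<d}"
  shows "moment l k = (\<integral>v. amplitude (\<lambda>i. a i * v $ \<pi> i) l * cnj (amplitude (\<lambda>i. a i * v $ \<pi> i) k) \<partial>\<mu>)"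
proof -
  have "moment l k = (\<integral>v. amplitude (($) (monomial_mat d \<pi> a *\<^sub>v v)) l *
      cnj (amplitude (($) (monomial_mat d \<pi> a *\<^sub>v v)) k) \<partial>\<mu>)"
    unfolding moment_def
    using integral_unitary[OF unitary_monomial_mat[OF \<pi> a]
        borel_measurable_integrable[OF moment_integrable[OF l]]] by simp
  also have "\<dots> = (\<integral>v. amplitude (\<lambda>i. a i * v $ \<pi> i) l * cnj (amplitude (\<lambda>i. a i * v $ \<pi> i) k) \<partial>\<mu>)"
  proof (intro Bochner_Integration.integral_cong refl arg_cong2[of _ _ _ _ "(*)"] arg_cong[of _ _ cnj] amplitude_cong)
    show "(monomial_mat d \<pi> a *\<^sub>v v) $ x = a x * v $ \<pi> x" if "v \<in> space \<mu>" "x \<in> set l" for v x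
      using that l by (intro monomial_mult_index[OF \<pi>]) (auto simp: space_haar)
    show "(monomial_mat d \<pi> a *\<^sub>v v) $ x = a x * v $ \<pi> x" if "v \<in> space \<mu>" "x \<in> set k" for v x
      using that l by (intro monomial_mult_index[OF \<pi>]) (auto simp: space_haar)
  qed
  finally show ?thesis .
qed

sublocale sign_invariant_vector \<mu> d "\<lambda>v x. v $ x"
proof unfold_locales
  fix x l k assume x: "x < d" and l: "set l \<subseteq> {..<d}" "set k \<subseteq> {..<d}"
    and odd: "odd (count_list l x + count_list k x)"
  let ?a = "\<lambda>i. if i = x then - 1 else 1 :: complex"
  have flip: "(\<lambda>i. ?a i * v $ id i) = (($) v)(x := - v $ x)" for v :: "complex vec"
    by auto
  have "moment l k = (\<integral>v. amplitude ((($) v)(x := - v $ x)) l * cnj (amplitude ((($) v)(x := - v $ x)) k) \<partial>\<mu>)"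
    using moment_monomial[OF permutes_id _ l, of ?a] unfolding flip by simp
  also have "\<dots> = (- 1) ^ (count_list l x + count_list k x) * moment l k"
    unfolding amplitude_flip moment_def
    by (simp add: power_add mult_ac flip: Bochner_Integration.integral_mult_right_zero)
  finally have "moment l k = (- 1) ^ (count_list l x + count_list k x) * moment l k" .
  then show "moment l k = 0" using odd by simp
qed

text \<open>Relabeling coordinates is unitary, so only the length of \<open>l\<close> matters. This
  makes the two averaged states proportional on distinct lists.\<close>

lemma moment_distinct_eq:
  assumes "distinct l" "set l \<subseteq> {..<d}"
  shows "moment l l = moment [0..<length l] [0..<length l]"
proof -
  obtain \<pi> where \<pi>: "\<pi> permutes {..<d}" and l: "l = map \<pi> [0..<length l]"
    using distinct_list_extends_to_permutation[OF assms] .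
  have len: "set [0..<length l] \<subseteq> {..<d}"
    using card_mono[OF _ assms(2)] distinct_card[OF assms(1)] by auto
  have "amplitude (\<lambda>i. 1 * v $ \<pi> i) [0..<length l] = amplitude (($) v) l" for v :: "complex vec"
    by (subst (2) l) (simp add: amplitude_def o_def)
  with moment_monomial[OF \<pi> _ len len, of "\<lambda>_. 1"] show ?thesis
    by (simp add: moment_def)
qed

section \<open>Fourth moments of a Haar-random state\<close>

definition fourth :: "nat \<Rightarrow> real" where
  "fourth x = (\<integral>v. cmod (v $ x) ^ 4 \<partial>\<mu>)"

definition cross :: "nat \<Rightarrow> nat \<Rightarrow> real" where
  "cross x y = (\<integral>v. (cmod (v $ x))\<^sup>2 * (cmod (v $ y))\<^sup>2 \<partial>\<mu>)"

lemma cross_integrable: "x < d \<Longrightarrow> y < d \<Longrightarrow> integrable \<mu> (\<lambda>v. (cmod (v $ x))\<^sup>2 * (cmod (v $ y))\<^sup>2)"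
  using prob_integrable[of "[x, y]"] by simp

lemma power4_cmod: "cmod z ^ 4 = (cmod z)\<^sup>2 * (cmod z)\<^sup>2"
  by (simp add: power2_eq_square power4_eq_xxxx)

lemma fourth_integrable: "x < d \<Longrightarrow> integrable \<mu> (\<lambda>v. cmod (v $ x) ^ 4)"
  unfolding power4_cmod by (rule cross_integrable)

text \<open>A phase on \<open>y\<close> followed by the Hadamard mixing is a unitary whose row
  \<open>x\<close> produces \<open>(v $ x + w * v $ y) / sqrt 2\<close>. This has the law of
  \<open>v $ x\<close>, and the factor 4 is the fourth power of \<open>sqrt 2\<close>.\<close>

lemma fourth_mix:
  assumes xy: "x < d" "y < d" "x \<noteq> y" and w: "cmod w = 1"
  shows "integrable \<mu> (\<lambda>v. cmod (v $ x + w * v $ y) ^ 4)"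
    and "(\<integral>v. cmod (v $ x + w * v $ y) ^ 4 \<partial>\<mu>) = 4 * fourth x"
proof -
  let ?D = "monomial_mat d id (\<lambda>i. if i = y then w else 1)" and ?U = "mixing_mat d x y"
  have D: "unitary_mat d ?D" using w by (intro unitary_monomial_mat permutes_id) auto
  have U: "unitary_mat d (?U * ?D)" by (intro unitary_mat_mult unitary_mixing_mat xy D)
  have idx: "(?U * ?D *\<^sub>v v) $ x = (v $ x + w * v $ y) / complex_of_real (sqrt 2)" if "v \<in> carrier_vec d" for v
  proof -
    have "(?U * ?D *\<^sub>v v) $ x = (?U *\<^sub>v (?D *\<^sub>v v)) $ x"
      using that xy unitary_mat_carrier[OF D] by (subst assoc_mult_mat_vec[of _ d d _ d]) (auto simp: mixing_mat_def)
    also have "\<dots> = (\<Sum>j<d. ?U $$ (x, j) * (?D *\<^sub>v v) $ j)"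
      using that xy mult_mat_vec_carrier[OF unitary_mat_carrier[OF D] that]
      by (intro mult_mat_vec_index) (auto simp: mixing_mat_def)
    also have "\<dots> = ((?D *\<^sub>v v) $ x + (?D *\<^sub>v v) $ y) / complex_of_real (sqrt 2)"
      using xy by (subst mixing_mat_sum) auto
    finally show ?thesis
      using that xy by (simp add: monomial_mult_index[OF permutes_id])
  qed
  have pw: "cmod ((?U * ?D *\<^sub>v v) $ x) ^ 4 = cmod (v $ x + w * v $ y) ^ 4 / 4" if "v \<in> space \<mu>" for v
  proof -
    have "sqrt 2 ^ 4 = 4" using power_mult[of "sqrt 2" 2 2] by simp
    then show ?thesis using that by (simp add: idx space_haar norm_divide power_divide)
  qed
  have meas: "(\<lambda>v. cmod (v $ x) ^ 4) \<in> borel_measurable \<mu>"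
    using fourth_integrable[OF xy(1)] by (rule borel_measurable_integrable)
  have "(\<integral>v. cmod (v $ x + w * v $ y) ^ 4 / 4 \<partial>\<mu>) = (\<integral>v. cmod ((?U * ?D *\<^sub>v v) $ x) ^ 4 \<partial>\<mu>)"
    by (intro Bochner_Integration.integral_cong refl) (simp add: pw)
  also have "\<dots> = fourth x"
    unfolding fourth_def by (rule integral_unitary[OF U meas])
  finally show "(\<integral>v. cmod (v $ x + w * v $ y) ^ 4 \<partial>\<mu>) = 4 * fourth x" by simp
  have bnd: "AE v in \<mu>. cmod (v $ x) \<le> 1" "AE v in \<mu>. cmod (v $ y) \<le> 1"
    using amplitude_bounded[of "[x]"] amplitude_bounded[of "[y]"] xy by simp_all
  show "integrable \<mu> (\<lambda>v. cmod (v $ x + w * v $ y) ^ 4)"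
  proof (rule integrable_const_bound[where B = "2 ^ 4"])
    show "AE v in \<mu>. norm (cmod (v $ x + w * v $ y) ^ 4) \<le> 2 ^ 4"
      using bnd
    proof eventually_elim
      case (elim v)
      have "cmod (v $ x + w * v $ y) \<le> 2"
        using norm_triangle_ineq[of "v $ x" "w * v $ y"] elim w by (simp add: norm_mult)
      then show ?case using power_mono[of "cmod (v $ x + w * v $ y)" 2 4] by simp
    qed
    show "(\<lambda>v. cmod (v $ x + w * v $ y) ^ 4) \<in> borel_measurable \<mu>"
      using coord_measurable[OF xy(1)] coord_measurable[OF xy(2)] by measurable
  qed
qed

text \<open>Adds \<open>fourth_mix\<close> over the four phases, total \<open>16 * fourth x\<close>,
  and compares with the expansion \<open>sum_phases_fourth_power\<close>.\<close>

lemma cross_eq: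
  assumes "x < d" "y < d" "x \<noteq> y"
  shows "16 * cross x y = 12 * fourth x - 4 * fourth y"
proof -
  note mix = fourth_mix[OF assms, of 1] fourth_mix[OF assms, of "- 1"]
    fourth_mix[OF assms, of \<i>] fourth_mix[OF assms, of "- \<i>"]
  have "16 * fourth x = (\<integral>v. cmod (v $ x + v $ y) ^ 4 + cmod (v $ x - v $ y) ^ 4
      + cmod (v $ x + \<i> * v $ y) ^ 4 + cmod (v $ x - \<i> * v $ y) ^ 4 \<partial>\<mu>)"
    using mix by simp
  also have "\<dots> = (\<integral>v. 4 * cmod (v $ x) ^ 4 + 4 * cmod (v $ y) ^ 4
      + 16 * ((cmod (v $ x))\<^sup>2 * (cmod (v $ y))\<^sup>2) \<partial>\<mu>)"
    unfolding sum_phases_fourth_power by (simp add: mult.assoc)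
  also have "\<dots> = 4 * fourth x + 4 * fourth y + 16 * cross x y"
    using assms by (simp add: fourth_integrable cross_integrable fourth_def cross_def)
  finally show ?thesis by simp
qed

text \<open>\<open>cross\<close> is symmetric, so exchanging \<open>x\<close> and \<open>y\<close>
  in \<open>cross_eq\<close> forces \<open>fourth x = fourth y\<close>.\<close>

lemma cross_half:
  assumes "x < d" "y < d" "x \<noteq> y"
  shows "cross x y = fourth x / 2"
proof -
  have "cross y x = cross x y" by (simp add: cross_def mult.commute)
  then show ?thesis using cross_eq[of x y] cross_eq[of y x] assms by simp
qed

text \<open>Square the normalisation and integrate: each \<open>x\<close> contributes
  \<open>fourth x\<close> once from the diagonal and half of it from each of the
  \<open>d - 1\<close> other labels.\<close>

lemma sum_fourth: "(\<integral>v. (\<Sum>x<d. cmod (v $ x) ^ 4) \<partial>\<mu>) = 2 / (real d + 1)"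
proof -
  have cross_self: "cross x x = fourth x" for x
    unfolding cross_def fourth_def power4_cmod ..
  have "1 = (\<integral>v. (\<Sum>x<d. \<Sum>y<d. (cmod (v $ x))\<^sup>2 * (cmod (v $ y))\<^sup>2) \<partial>\<mu>)"
  proof -
    have "(\<integral>v. (\<Sum>x<d. \<Sum>y<d. (cmod (v $ x))\<^sup>2 * (cmod (v $ y))\<^sup>2) \<partial>\<mu>) = (\<integral>v. 1 \<partial>\<mu>)"
    proof (rule integral_cong_AE)
      show "AE v in \<mu>. (\<Sum>x<d. \<Sum>y<d. (cmod (v $ x))\<^sup>2 * (cmod (v $ y))\<^sup>2) = 1"
        using unit by eventually_elim (simp only: sum_product[symmetric] mult_1)
      show "(\<lambda>v. \<Sum>x<d. \<Sum>y<d. (cmod (v $ x))\<^sup>2 * (cmod (v $ y))\<^sup>2) \<in> borel_measurable \<mu>"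
        by (intro borel_measurable_sum borel_measurable_integrable[OF cross_integrable]) auto
    qed simp
    then show ?thesis by (simp add: prob_space)
  qed
  also have "\<dots> = (\<Sum>x<d. \<integral>v. (\<Sum>y<d. (cmod (v $ x))\<^sup>2 * (cmod (v $ y))\<^sup>2) \<partial>\<mu>)"
    by (intro Bochner_Integration.integral_sum Bochner_Integration.integrable_sum cross_integrable) auto
  also have "\<dots> = (\<Sum>x<d. \<Sum>y<d. cross x y)"
    unfolding cross_def by (intro sum.cong refl Bochner_Integration.integral_sum cross_integrable) auto
  \<comment> \<open>The diagonal term is written as two halves, so that the first summand is uniform
    in \<open>y\<close>.\<close>
  also have "\<dots> = (\<Sum>x<d. \<Sum>y<d. fourth x / 2 + (if y = x then fourth x / 2 else 0))"
    by (intro sum.cong refl) (auto simp: cross_half cross_self)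
  also have "\<dots> = (\<Sum>x<d. fourth x) * ((real d + 1) / 2)"
    unfolding sum_distrib_right
    by (intro sum.cong refl) (simp add: sum.distrib distrib_left add_divide_distrib)
  finally have "(\<Sum>x<d. fourth x) = 2 / (real d + 1)"
    by (simp add: field_simps)
  then show ?thesis by (simp add: fourth_def fourth_integrable)
qed

end

text \<open>Both fourth-moment sums, \<open>1 / d\<close> and \<open>2 / (d + 1)\<close>, are at
  most \<open>2 / d\<close>. The trace norm is then at most
  \<open>3 * (t\<^sup>2 / 2) * (2 / d)\<close>, and the half in the trace distance leaves the
  constant 3/2.\<close>

lemma trace_distance_le:
  assumes "haar_state_measure (2 ^ n) \<mu>"
  shows "trace_distance
      (expectation_mat ((2 ^ n) ^ t) (measure_pmf (random_signs (2 ^ n)))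
        (\<lambda>\<alpha>. tensor_power (ket_bra (binary_phase_state n \<alpha>)) t))
      (expectation_mat ((2 ^ n) ^ t) \<mu> (\<lambda>\<theta>. tensor_power (ket_bra \<theta>) t))
    \<le> 3 / 2 * (real t)\<^sup>2 / 2 ^ n"
proof -
  define d :: nat where "d = 2 ^ n"
  have d: "d > 0" by (simp add: d_def)
  let ?M = "measure_pmf (random_signs d)"
  interpret R: sign_invariant_vector ?M d "sign_vector d"
    using d by (rule sign_vector_invariant)
  interpret S: haar_state d \<mu>
    using assms d by unfold_locales (simp_all add: d_def)
  \<comment> \<open>The ratio of the Haar moment of a distinct list to the sign moment
    \<open>(1 / d) ^ t\<close>. For \<open>t > d\<close> there are no distinct lists of length
    \<open>t\<close>, and the proportionality holds vacuously.\<close>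
  define c where "c = d ^ t * Re (S.moment [0..<t] [0..<t])"
  have "trace_norm (mat (d ^ t) (d ^ t) (\<lambda>(i, j). R.tensor_moment t i j)
      - mat (d ^ t) (d ^ t) (\<lambda>(i, j). S.tensor_moment t i j)) \<le> 3 * ((real t)\<^sup>2 / 2 * (2 / d))"
  proof (rule trace_norm_tensor_moment_diff_le)
    show "S.moment l l = complex_of_real c * R.moment l l"
      if "distinct l" "set l \<subseteq> {..<d}" "length l = t" for l
    proof -
      have "S.moment l l = complex_of_real (Re (S.moment [0..<t] [0..<t]))"
        using S.moment_distinct_eq[OF that(1,2)] that(3) by (simp add: S.moment_diag)
      moreover have "c * (1 / d) ^ t = Re (S.moment [0..<t] [0..<t])"
        using d by (simp add: c_def power_divide)
      ultimately show ?thesis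
        using that d by (simp only: sign_vector_moment of_real_mult[symmetric])
    qed
    show "(\<integral>\<alpha>. (\<Sum>x<d. cmod (sign_vector d \<alpha> x) ^ 4) \<partial>?M) \<le> 2 / d"
      using d by (simp add: sign_vector_fourth_moment divide_right_mono)
    show "(\<integral>v. (\<Sum>x<d. cmod (v $ x) ^ 4) \<partial>\<mu>) \<le> 2 / d"
      using d by (simp add: S.sum_fourth frac_le)
  qed (rule R.sign_invariant_vector_axioms S.sign_invariant_vector_axioms)+
  \<comment> \<open>It remains to identify the two moment matrices with the averaged tensor powers,
    entry by entry through the digits of the indices.\<close>
  also have "mat (d ^ t) (d ^ t) (\<lambda>(i, j). R.tensor_moment t i j)
      = expectation_mat (d ^ t) ?M (\<lambda>\<alpha>. tensor_power (ket_bra (binary_phase_state n \<alpha>)) t)"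
  proof -
    have "tensor_power (ket_bra (binary_phase_state n \<alpha>)) t $$ (i, j)
        = amplitude (sign_vector d \<alpha>) (digits d t i) * cnj (amplitude (sign_vector d \<alpha>) (digits d t j))"
      if "i < d ^ t" "j < d ^ t" for i j \<alpha>
    proof -
      have "amplitude (($) (binary_phase_state n \<alpha>)) (digits d t i) = amplitude (sign_vector d \<alpha>) (digits d t i)"
        if "i < d ^ t" for i
        using set_digits[OF that]
        by (intro amplitude_cong) (auto simp: binary_phase_state_def sign_vector_def d_def)
      moreover have "dim_vec (binary_phase_state n \<alpha>) = d"
        by (simp add: binary_phase_state_def d_def)
      ultimately show ?thesis
        using tensor_power_ket_bra_index[of "binary_phase_state n \<alpha>" d i t j] that by simp
    qed
    then show ?thesis
      unfolding expectation_mat_def by (intro eq_matI) (auto simp: R.tensor_moment_def R.moment_def)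
  qed
  also have "mat (d ^ t) (d ^ t) (\<lambda>(i, j). S.tensor_moment t i j)
      = expectation_mat (d ^ t) \<mu> (\<lambda>\<theta>. tensor_power (ket_bra \<theta>) t)"
  proof -
    have "S.tensor_moment t i j = (\<integral>\<theta>. tensor_power (ket_bra \<theta>) t $$ (i, j) \<partial>\<mu>)"
      if "i < d ^ t" "j < d ^ t" for i j
      unfolding S.tensor_moment_def S.moment_def
      using tensor_power_ket_bra_index[OF _ that]
      by (intro Bochner_Integration.integral_cong refl) (auto simp: S.space_haar)
    then show ?thesis
      unfolding expectation_mat_def by (intro eq_matI) auto
  qed
  finally show ?thesis
    by (simp add: trace_distance_def d_def)
qed

theorem lemma5p8:
  shows "\<exists>C::real. \<forall>(t::nat) (n::nat) (\<mu>::complex vec measure).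
    haar_state_measure (2 ^ n) \<mu> \<longrightarrow>
    trace_distance
      (expectation_mat ((2 ^ n) ^ t) (measure_pmf (random_signs (2 ^ n)))
        (\<lambda>\<alpha>. tensor_power (ket_bra (binary_phase_state n \<alpha>)) t))
      (expectation_mat ((2 ^ n) ^ t) \<mu> (\<lambda>\<theta>. tensor_power (ket_bra \<theta>) t))
    \<le> C * (real t)\<^sup>2 / 2 ^ n"
  by (intro exI[of _ "3 / 2"] allI impI trace_distance_le)

end
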